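(* Let $M$ and $N$ be objects of an abelian category $\mathcal{A}$, $M'$ a direct summand of $M$ and $N'$ a direct summand of $N$. (1) If $N$ is $M$-CS-Rickart, then $N'$ is $M'$-CS-Rickart. (2) If $N$ is dual $M$-CS-Rickart, then $N'$ is dual $M'$-CS-Rickart.
   Context: A subobject $K$ of $L$ is essential in $L$ if $K\cap X=0$ implies $X=0$ for every subobject $X$ of $L$; $K$ is superfluous in $L$ if $K+X=L$ implies $X=L$ for every subobject $X$ of $L$. A subobject $L$ of $M$ lies above a direct summand of $M$ if $L$ contains a direct summand $K$ of $M$ such that $L/K$ is superfluous in $M/K$. For objects $M,N$ of an abelian category: $N$ is $M$-CS-Rickart if for every morphism $f:M\to N$, $\mathrm{Ker}(f)$ is essential in a direct summand of $M$; $N$ is dual $M$-CS-Rickart if for every morphism $f:M\to N$, $\mathrm{Im}(f)$ lies above a direct summand of $N$. *)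

theory Defs
  imports "HOL-Algebra.Group"
begin

record ('o, 'a) preadditive_cat =
  Obj :: "'o set"
  Arr :: "'a set"
  Dom :: "'a \<Rightarrow> 'o"
  Cod :: "'a \<Rightarrow> 'o"
  Ident :: "'o \<Rightarrow> 'a"
  Comp :: "'a \<Rightarrow> 'a \<Rightarrow> 'a" (infixr "\<cdot>\<index>" 70)
  Add :: "'a \<Rightarrow> 'a \<Rightarrow> 'a" (infixl "\<boxplus>\<index>" 65)
  Zero :: "'o \<Rightarrow> 'o \<Rightarrow> 'a"

context
  fixes C :: "('o, 'a, 'r) preadditive_cat_scheme" (structure)
begin

definition homset :: "'o \<Rightarrow> 'o \<Rightarrow> 'a set"
  where "homset A B = {f \<in> Arr C. Dom C f = A \<and> Cod C f = B}"

definition hom_group :: "'o \<Rightarrow> 'o \<Rightarrow> 'a monoid"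
  where "hom_group A B = \<lparr>carrier = homset A B, mult = Add C, one = Zero C A B\<rparr>"

definition is_mono :: "'a \<Rightarrow> bool"
  where "is_mono m \<longleftrightarrow> m \<in> Arr C \<and>
    (\<forall>A. \<forall>g \<in> homset A (Dom C m). \<forall>h \<in> homset A (Dom C m). m \<cdot> g = m \<cdot> h \<longrightarrow> g = h)"

definition is_epi :: "'a \<Rightarrow> bool"
  where "is_epi e \<longleftrightarrow> e \<in> Arr C \<and>
    (\<forall>B. \<forall>g \<in> homset (Cod C e) B. \<forall>h \<in> homset (Cod C e) B. g \<cdot> e = h \<cdot> e \<longrightarrow> g = h)"

definition is_zero_object :: "'o \<Rightarrow> bool"
  where "is_zero_object Z \<longleftrightarrow> Z \<in> Obj C \<and>
    (\<forall>A \<in> Obj C. (\<exists>!f. f \<in> homset A Z) \<and> (\<exists>!f. f \<in> homset Z A))"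

definition is_biproduct :: "'o \<Rightarrow> 'o \<Rightarrow> 'o \<Rightarrow> 'a \<Rightarrow> 'a \<Rightarrow> 'a \<Rightarrow> 'a \<Rightarrow> bool"
  where "is_biproduct A B S i j p q \<longleftrightarrow>
    i \<in> homset A S \<and> j \<in> homset B S \<and> p \<in> homset S A \<and> q \<in> homset S B \<and>
    p \<cdot> i = Ident C A \<and> q \<cdot> j = Ident C B \<and>
    q \<cdot> i = Zero C A B \<and> p \<cdot> j = Zero C B A \<and>
    (i \<cdot> p) \<boxplus> (j \<cdot> q) = Ident C S"

definition is_kernel :: "'a \<Rightarrow> 'a \<Rightarrow> bool"
  where "is_kernel k f \<longleftrightarrow> f \<in> Arr C \<and> k \<in> homset (Dom C k) (Dom C f) \<and>
    f \<cdot> k = Zero C (Dom C k) (Cod C f) \<and>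
    (\<forall>A. \<forall>h \<in> homset A (Dom C f). f \<cdot> h = Zero C A (Cod C f) \<longrightarrow>
      (\<exists>!u. u \<in> homset A (Dom C k) \<and> k \<cdot> u = h))"

definition is_cokernel :: "'a \<Rightarrow> 'a \<Rightarrow> bool"
  where "is_cokernel c f \<longleftrightarrow> f \<in> Arr C \<and> c \<in> homset (Cod C f) (Cod C c) \<and>
    c \<cdot> f = Zero C (Dom C f) (Cod C c) \<and>
    (\<forall>B. \<forall>h \<in> homset (Cod C f) B. h \<cdot> f = Zero C (Dom C f) B \<longrightarrow>
      (\<exists>!u. u \<in> homset (Cod C c) B \<and> u \<cdot> c = h))"

definition is_image :: "'a \<Rightarrow> 'a \<Rightarrow> bool"
  where "is_image m f \<longleftrightarrow> (\<exists>c. is_cokernel c f \<and> is_kernel m c)"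

end

locale category =
  fixes C :: "('o, 'a, 'r) preadditive_cat_scheme" (structure)
  assumes Dom_in_Obj: "f \<in> Arr C \<Longrightarrow> Dom C f \<in> Obj C"
    and Cod_in_Obj: "f \<in> Arr C \<Longrightarrow> Cod C f \<in> Obj C"
    and Ident_in_homset: "A \<in> Obj C \<Longrightarrow> Ident C A \<in> homset C A A"
    and Comp_in_homset: "\<lbrakk>f \<in> homset C A B; g \<in> homset C B D\<rbrakk> \<Longrightarrow> g \<cdot> f \<in> homset C A D"
    and Comp_Ident_left: "f \<in> homset C A B \<Longrightarrow> Ident C B \<cdot> f = f"
    and Comp_Ident_right: "f \<in> homset C A B \<Longrightarrow> f \<cdot> Ident C A = f"
    and Comp_assoc: "\<lbrakk>f \<in> homset C A B; g \<in> homset C B D; h \<in> homset C D E\<rbrakk>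
          \<Longrightarrow> (h \<cdot> g) \<cdot> f = h \<cdot> (g \<cdot> f)"

locale preadditive_category = category +
  assumes comm_group_hom: "\<lbrakk>A \<in> Obj C; B \<in> Obj C\<rbrakk> \<Longrightarrow> comm_group (hom_group C A B)"
    and Comp_Add_left: "\<lbrakk>f \<in> homset C A B; g \<in> homset C B D; h \<in> homset C B D\<rbrakk>
          \<Longrightarrow> (g \<boxplus> h) \<cdot> f = (g \<cdot> f) \<boxplus> (h \<cdot> f)"
    and Comp_Add_right: "\<lbrakk>f \<in> homset C A B; g \<in> homset C A B; h \<in> homset C B D\<rbrakk>
          \<Longrightarrow> h \<cdot> (f \<boxplus> g) = (h \<cdot> f) \<boxplus> (h \<cdot> g)"

locale abelian_category = preadditive_category +
  assumes zero_object_exists: "\<exists>Z. is_zero_object C Z"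
    and biproduct_exists: "\<lbrakk>A \<in> Obj C; B \<in> Obj C\<rbrakk> \<Longrightarrow> \<exists>S i j p q. is_biproduct C A B S i j p q"
    and kernel_exists: "f \<in> Arr C \<Longrightarrow> \<exists>k. is_kernel C k f"
    and cokernel_exists: "f \<in> Arr C \<Longrightarrow> \<exists>c. is_cokernel C c f"
    and mono_is_kernel: "is_mono C m \<Longrightarrow> \<exists>f. is_kernel C m f"
    and epi_is_cokernel: "is_epi C e \<Longrightarrow> \<exists>f. is_cokernel C e f"

text \<open>
  A subobject of \<open>L\<close> is represented by a monomorphism with codomain \<open>L\<close>. Two of them are the
  same subobject if each factors through the other, and all notions below are invariant under
  this equivalence. Kernels, cokernels, images, intersections and sums are likewise only
  determined up to isomorphism, so they appear as relations rather than as chosen values.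
\<close>

context
  fixes C :: "('o, 'a, 'r) preadditive_cat_scheme" (structure)
begin

definition is_subobject :: "'a \<Rightarrow> 'o \<Rightarrow> bool"
  where "is_subobject k L \<longleftrightarrow> is_mono C k \<and> Cod C k = L"

definition sub_le :: "'a \<Rightarrow> 'a \<Rightarrow> bool"
  where "sub_le k l \<longleftrightarrow> (\<exists>u \<in> homset C (Dom C k) (Dom C l). l \<cdot> u = k)"

definition sub_eq :: "'a \<Rightarrow> 'a \<Rightarrow> bool"
  where "sub_eq k l \<longleftrightarrow> sub_le k l \<and> sub_le l k"

text \<open>Intersection and sum are the meet and the join in the ordered class of subobjects of \<open>L\<close>.\<close>

definition is_intersection :: "'o \<Rightarrow> 'a \<Rightarrow> 'a \<Rightarrow> 'a \<Rightarrow> bool"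
  where "is_intersection L k x m \<longleftrightarrow> is_subobject m L \<and> sub_le m k \<and> sub_le m x \<and>
    (\<forall>n. is_subobject n L \<and> sub_le n k \<and> sub_le n x \<longrightarrow> sub_le n m)"

definition is_sum :: "'o \<Rightarrow> 'a \<Rightarrow> 'a \<Rightarrow> 'a \<Rightarrow> bool"
  where "is_sum L k x s \<longleftrightarrow> is_subobject s L \<and> sub_le k s \<and> sub_le x s \<and>
    (\<forall>n. is_subobject n L \<and> sub_le k n \<and> sub_le x n \<longrightarrow> sub_le s n)"

definition essential :: "'a \<Rightarrow> 'o \<Rightarrow> bool"
  where "essential k L \<longleftrightarrow> is_subobject k L \<and>
    (\<forall>x. is_subobject x L \<longrightarrow>
      (\<exists>m. is_intersection L k x m \<and> is_zero_object C (Dom C m)) \<longrightarrow>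
      is_zero_object C (Dom C x))"

text \<open>The subobject \<open>L\<close> of \<open>L\<close> itself is represented by its identity.\<close>

definition superfluous :: "'a \<Rightarrow> 'o \<Rightarrow> bool"
  where "superfluous k L \<longleftrightarrow> is_subobject k L \<and>
    (\<forall>x. is_subobject x L \<longrightarrow>
      (\<exists>s. is_sum L k x s \<and> sub_eq s (Ident C L)) \<longrightarrow>
      sub_eq x (Ident C L))"

definition summand_inclusion :: "'a \<Rightarrow> 'o \<Rightarrow> bool"
  where "summand_inclusion u M \<longleftrightarrow> (\<exists>V v p q. is_biproduct C (Dom C u) V M u v p q)"

definition direct_summand :: "'o \<Rightarrow> 'o \<Rightarrow> bool"
  where "direct_summand U M \<longleftrightarrow> (\<exists>u \<in> homset C U M. summand_inclusion u M)"

text \<open>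
  Here \<open>j\<close> is the inclusion of \<open>K\<close> in \<open>L\<close>, the cokernels \<open>c\<close> and \<open>d\<close> present \<open>M/K\<close> and
  \<open>L/K\<close>, and \<open>v\<close> is the induced map from \<open>L/K\<close> to \<open>M/K\<close>.
\<close>

definition lies_above_summand :: "'a \<Rightarrow> 'o \<Rightarrow> bool"
  where "lies_above_summand l M \<longleftrightarrow> is_subobject l M \<and>
    (\<exists>k j c d v. summand_inclusion k M \<and>
      j \<in> homset C (Dom C k) (Dom C l) \<and> l \<cdot> j = k \<and>
      is_cokernel C c k \<and> is_cokernel C d j \<and>
      v \<in> homset C (Cod C d) (Cod C c) \<and> v \<cdot> d = c \<cdot> l \<and>
      superfluous v (Cod C c))"

text \<open>\<open>cs_rickart C M N\<close> says that \<open>N\<close> is \<open>M\<close>-CS-Rickart, and similarly for the dual notion.\<close>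

definition cs_rickart :: "'o \<Rightarrow> 'o \<Rightarrow> bool"
  where "cs_rickart M N \<longleftrightarrow> (\<forall>f \<in> homset C M N.
    \<exists>k u j. is_kernel C k f \<and> summand_inclusion u M \<and>
      j \<in> homset C (Dom C k) (Dom C u) \<and> u \<cdot> j = k \<and>
      essential j (Dom C u))"

definition dual_cs_rickart :: "'o \<Rightarrow> 'o \<Rightarrow> bool"
  where "dual_cs_rickart M N \<longleftrightarrow> (\<forall>f \<in> homset C M N.
    \<exists>m. is_image C m f \<and> lies_above_summand m N)"

end

end

theory Submission
  imports Defs
begin

text \<open>
  An arrow \<open>f : M' \<rightarrow> N'\<close> between the summands extends by zero to an arrow \<open>g : M \<rightarrow> N\<close>, and with
  \<open>M = M' \<oplus> M''\<close> the kernel of \<open>g\<close> is \<open>Ker f \<oplus> M''\<close>. If \<open>Ker g\<close> is essential in a summand \<open>U\<close> of \<open>M\<close>,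
  then \<open>M'' \<le> U\<close>, so \<open>U = U' \<oplus> M''\<close> for a summand \<open>U'\<close> that projects isomorphically onto a summand of
  \<open>M'\<close>, and \<open>Ker f\<close> is essential in that summand. This is \<open>cs_rickart_direct_summand\<close>, the first
  half of the theorem.

  The second half is the first one in the opposite category. The definitions are not visibly dual
  to each other, as both speak of subobjects, one through meets and one through joins and quotients.
  So both are first rewritten in terms of arrows. A monomorphism \<open>j\<close> is essential iff \<open>x \<cdot> j\<close> mono
  implies \<open>x\<close> mono (\<open>essential_iff\<close>), and a monomorphism with cokernel \<open>q\<close> is superfluous iff \<open>q \<cdot> x\<close>
  epi implies \<open>x\<close> epi (\<open>superfluous_iff\<close>). Moreover an image \<open>m\<close> with cokernel \<open>c\<close> lies above a summand
  iff \<open>c\<close> is a split epimorphism followed by such a \<open>q\<close> (\<open>dual_cs_rickart_iff\<close>), which is the dual of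
  a kernel being such a \<open>j\<close> followed by a split monomorphism.
\<close>

section \<open>Calculus of arrows\<close>

text \<open>
  Membership in a hom-set is reduced to equations for \<open>Dom\<close> and \<open>Cod\<close>. The laws below are restated
  with such equations as premises, so that the simplifier can check composability by itself.
\<close>

declare homset_def [simp]

context category
begin

lemma Comp_simps [simp]:
  assumes "f \<in> Arr C" and "g \<in> Arr C" and "Cod C f = Dom C g"
  shows "g \<cdot> f \<in> Arr C" and "Dom C (g \<cdot> f) = Dom C f" and "Cod C (g \<cdot> f) = Cod C g"
  using Comp_in_homset[of f "Dom C f" "Cod C f" g "Cod C g"] assms by auto

lemma Comp_assoc_Arr [simp]:
  assumes "f \<in> Arr C" and "g \<in> Arr C" and "h \<in> Arr C"
    and "Cod C f = Dom C g" and "Cod C g = Dom C h"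
  shows "(h \<cdot> g) \<cdot> f = h \<cdot> (g \<cdot> f)"
  using Comp_assoc[of f "Dom C f" "Cod C f" g "Cod C g" h "Cod C h"] assms by auto

text \<open>An equation \<open>g \<cdot> f = h\<close> becomes a rewrite rule for right-nested composites.\<close>

lemma Comp_extend:
  assumes "g \<cdot> f = h" and "f \<in> Arr C" and "g \<in> Arr C" and "Cod C f = Dom C g"
    and "w \<in> Arr C" and "Cod C w = Dom C f"
  shows "g \<cdot> (f \<cdot> w) = h \<cdot> w"
  using Comp_assoc_Arr[of w f g] assms by simp

lemma Ident_simps [simp]:
  assumes "A \<in> Obj C"
  shows "Ident C A \<in> Arr C" and "Dom C (Ident C A) = A" and "Cod C (Ident C A) = A"
  using Ident_in_homset[OF assms] by auto

lemma Comp_Ident_simps [simp]: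
  "\<lbrakk>f \<in> Arr C; Cod C f = B\<rbrakk> \<Longrightarrow> Ident C B \<cdot> f = f"
  "\<lbrakk>f \<in> Arr C; Dom C f = A\<rbrakk> \<Longrightarrow> f \<cdot> Ident C A = f"
  using Comp_Ident_left[of f "Dom C f" B] Comp_Ident_right[of f A "Cod C f"] by auto

declare Dom_in_Obj [simp] Cod_in_Obj [simp]

lemma mono_cancel:
  assumes "is_mono C m" and "g \<in> homset C A (Dom C m)" and "h \<in> homset C A (Dom C m)"
    and "m \<cdot> g = m \<cdot> h"
  shows "g = h"
  using assms unfolding is_mono_def by blast

lemma mono_Arr: "is_mono C m \<Longrightarrow> m \<in> Arr C"
  by (simp add: is_mono_def)

lemma mono_Comp:
  assumes "is_mono C m" and "is_mono C n" and "Cod C n = Dom C m"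
  shows "is_mono C (m \<cdot> n)"
  using assms unfolding is_mono_def by auto

lemma mono_of_Comp_mono:
  assumes "is_mono C (m \<cdot> n)" and "m \<in> Arr C" and "n \<in> Arr C" and "Cod C n = Dom C m"
  shows "is_mono C n"
  unfolding is_mono_def
proof (intro conjI allI ballI impI)
  show "n \<in> Arr C" by fact
  fix A g h
  assume g: "g \<in> homset C A (Dom C n)" and h: "h \<in> homset C A (Dom C n)" and e: "n \<cdot> g = n \<cdot> h"
  then have "(m \<cdot> n) \<cdot> g = (m \<cdot> n) \<cdot> h" using assms by simp
  then show "g = h" using mono_cancel[OF assms(1), of g A h] g h assms by simp
qed

lemma split_mono:
  assumes "u \<in> homset C U M" and "r \<in> homset C M U" and "r \<cdot> u = Ident C U"
  shows "is_mono C u"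
proof (rule mono_of_Comp_mono)
  have "U \<in> Obj C" using assms(1) by auto
  then show "is_mono C (r \<cdot> u)" unfolding assms(3) by (simp add: is_mono_def)
qed (use assms in auto)

end

context preadditive_category
begin

lemma Add_simps:
  assumes "f \<in> homset C A B" and "g \<in> homset C A B"
  shows "f \<boxplus> g \<in> homset C A B" and "f \<boxplus> g = g \<boxplus> f" and "Zero C A B \<boxplus> f = f"
proof -
  have "A \<in> Obj C" and "B \<in> Obj C" using assms by auto
  then interpret G: comm_group "hom_group C A B" by (rule comm_group_hom)
  show "f \<boxplus> g \<in> homset C A B" "f \<boxplus> g = g \<boxplus> f" "Zero C A B \<boxplus> f = f"
    using G.m_closed[of f g] G.m_comm[of f g] G.l_one[of f] assms
    by (auto simp: hom_group_def)
qed

lemma Zero_simps [simp]: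
  assumes "A \<in> Obj C" and "B \<in> Obj C"
  shows "Zero C A B \<in> Arr C" and "Dom C (Zero C A B) = A" and "Cod C (Zero C A B) = B"
proof -
  interpret G: comm_group "hom_group C A B" using assms by (rule comm_group_hom)
  show "Zero C A B \<in> Arr C" "Dom C (Zero C A B) = A" "Cod C (Zero C A B) = B"
    using G.one_closed by (auto simp: hom_group_def)
qed

lemma Add_right_cancel:
  assumes "f \<in> homset C A B" and "g \<in> homset C A B" and "h \<in> homset C A B"
    and "f \<boxplus> h = g \<boxplus> h"
  shows "f = g"
proof -
  have "A \<in> Obj C" and "B \<in> Obj C" using assms by auto
  then interpret G: comm_group "hom_group C A B" by (rule comm_group_hom)
  show ?thesis using G.right_cancel[of h f g] assms by (auto simp: hom_group_def)
qed

lemma difference_exists: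
  assumes "f \<in> homset C A B" and "g \<in> homset C A B"
  shows "\<exists>d \<in> homset C A B. d \<boxplus> g = f"
proof -
  have "A \<in> Obj C" and "B \<in> Obj C" using assms by auto
  then interpret G: comm_group "hom_group C A B" by (rule comm_group_hom)
  let ?G = "hom_group C A B"
  have fg: "f \<in> carrier ?G" "g \<in> carrier ?G" using assms by (auto simp: hom_group_def)
  have "(f \<otimes>\<^bsub>?G\<^esub> inv\<^bsub>?G\<^esub> g) \<otimes>\<^bsub>?G\<^esub> g = f"
    using fg by (simp add: G.m_assoc)
  moreover have "f \<otimes>\<^bsub>?G\<^esub> inv\<^bsub>?G\<^esub> g \<in> carrier ?G" using fg by simp
  ultimately show ?thesis unfolding hom_group_def by auto
qed

lemma Add_eq_right:
  assumes "f \<in> homset C A B" and "g \<in> homset C A B" and "f \<boxplus> g = g"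
  shows "f = Zero C A B"
proof -
  have "A \<in> Obj C" and "B \<in> Obj C" using assms by auto
  then have "Zero C A B \<in> homset C A B" by simp
  then show ?thesis
    using Add_right_cancel[of f A B "Zero C A B" g] Add_simps(3)[OF assms(2,2)] assms by simp
qed

lemma Comp_Zero [simp]:
  assumes "f \<in> Arr C" and "A \<in> Obj C" and "Dom C f = B"
  shows "f \<cdot> Zero C A B = Zero C A (Cod C f)"
proof -
  have B: "B \<in> Obj C" using assms by auto
  let ?z = "Zero C A B"
  have z: "?z \<in> homset C A B" using assms B by simp
  have "(f \<cdot> ?z) \<boxplus> (f \<cdot> ?z) = f \<cdot> (?z \<boxplus> ?z)"
    using Comp_Add_right[OF z z, of f "Cod C f"] assms by simp
  also have "\<dots> = f \<cdot> ?z" using Add_simps(3)[OF z z] by simp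
  finally show ?thesis using Add_eq_right[of "f \<cdot> ?z" A "Cod C f" "f \<cdot> ?z"] assms B by simp
qed

lemma Zero_Comp [simp]:
  assumes "f \<in> Arr C" and "A \<in> Obj C" and "Cod C f = B"
  shows "Zero C B A \<cdot> f = Zero C (Dom C f) A"
proof -
  have B: "B \<in> Obj C" using assms by auto
  let ?z = "Zero C B A"
  have z: "?z \<in> homset C B A" using assms B by simp
  have "(?z \<cdot> f) \<boxplus> (?z \<cdot> f) = (?z \<boxplus> ?z) \<cdot> f"
    using Comp_Add_left[OF _ z z, of f "Dom C f"] assms by simp
  also have "\<dots> = ?z \<cdot> f" using Add_simps(3)[OF z z] by simp
  finally show ?thesis using Add_eq_right[of "?z \<cdot> f" "Dom C f" A "?z \<cdot> f"] assms B by simp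
qed

lemma mono_zeroD:
  assumes "is_mono C m" and "g \<in> homset C A (Dom C m)" and "m \<cdot> g = Zero C A (Cod C m)"
  shows "g = Zero C A (Dom C m)"
proof -
  have "A \<in> Obj C" "m \<in> Arr C" using assms by (auto simp: is_mono_def)
  then show ?thesis using assms mono_cancel[OF assms(1), of g A "Zero C A (Dom C m)"] by simp
qed

text \<open>The difference of two arrows that \<open>m\<close> identifies is killed by \<open>m\<close>.\<close>

lemma mono_zeroI:
  assumes m: "m \<in> Arr C"
    and z: "\<And>A g. \<lbrakk>g \<in> homset C A (Dom C m); m \<cdot> g = Zero C A (Cod C m)\<rbrakk> \<Longrightarrow> g = Zero C A (Dom C m)"
  shows "is_mono C m"
  unfolding is_mono_def
proof (intro conjI allI ballI impI)
  fix A g h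
  assume g: "g \<in> homset C A (Dom C m)" and h: "h \<in> homset C A (Dom C m)" and e: "m \<cdot> g = m \<cdot> h"
  obtain d where d: "d \<in> homset C A (Dom C m)" and dh: "d \<boxplus> h = g"
    using difference_exists[OF g h] by blast
  have "(m \<cdot> d) \<boxplus> (m \<cdot> h) = m \<cdot> h"
    using Comp_Add_right[OF d h, of m "Cod C m"] m dh e by simp
  then have "m \<cdot> d = Zero C A (Cod C m)"
    using Add_eq_right[of "m \<cdot> d" A "Cod C m" "m \<cdot> h"] d h m by simp
  then have "d = Zero C A (Dom C m)" using z d by blast
  then show "g = h" using Add_simps(3)[OF h h] dh by simp
qed fact

text \<open>Uniqueness of the factorizations through \<open>k\<close> amounts to \<open>k\<close> being a monomorphism.\<close>

lemma is_kernel_iff: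
  "is_kernel C k f \<longleftrightarrow> f \<in> Arr C \<and> is_mono C k \<and> Cod C k = Dom C f \<and>
     f \<cdot> k = Zero C (Dom C k) (Cod C f) \<and>
     (\<forall>A. \<forall>h \<in> homset C A (Dom C f). f \<cdot> h = Zero C A (Cod C f) \<longrightarrow>
       (\<exists>u \<in> homset C A (Dom C k). k \<cdot> u = h))" (is "?L \<longleftrightarrow> ?R")
proof
  assume L: ?L
  then have k: "k \<in> Arr C" "Cod C k = Dom C f" and f: "f \<in> Arr C"
    and fk: "f \<cdot> k = Zero C (Dom C k) (Cod C f)"
    and ex1: "\<And>A h. \<lbrakk>h \<in> homset C A (Dom C f); f \<cdot> h = Zero C A (Cod C f)\<rbrakk> \<Longrightarrow>
      \<exists>!u. u \<in> homset C A (Dom C k) \<and> k \<cdot> u = h"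
    unfolding is_kernel_def by auto
  have "is_mono C k"
    unfolding is_mono_def
  proof (intro conjI allI ballI impI)
    fix A g h
    assume g: "g \<in> homset C A (Dom C k)" and h: "h \<in> homset C A (Dom C k)" and e: "k \<cdot> g = k \<cdot> h"
    have "f \<cdot> (k \<cdot> g) = Zero C A (Cod C f)" using Comp_extend[OF fk] f k g by simp
    then have "\<exists>!u. u \<in> homset C A (Dom C k) \<and> k \<cdot> u = k \<cdot> g"
      using ex1[of "k \<cdot> g" A] f k g by simp
    then show "g = h" using g h e by metis
  qed fact
  then show ?R using k f fk ex1 by blast
next
  assume R: ?R
  then show ?L
    unfolding is_kernel_def using mono_cancel[of k] mono_Arr[of k] by fastforce
qed

lemma kernel_factor:
  assumes "is_kernel C k f" and "h \<in> homset C A (Dom C f)" and "f \<cdot> h = Zero C A (Cod C f)"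
  shows "\<exists>u \<in> homset C A (Dom C k). k \<cdot> u = h"
  using assms unfolding is_kernel_iff by blast

text \<open>Every arrow from or to \<open>A\<close> factors through the identity of \<open>A\<close>.\<close>

lemma is_zero_object_iff:
  assumes "A \<in> Obj C"
  shows "is_zero_object C A \<longleftrightarrow> Ident C A = Zero C A A"
proof
  assume "is_zero_object C A"
  then have "\<exists>!f. f \<in> homset C A A" using assms unfolding is_zero_object_def by blast
  moreover have "Ident C A \<in> homset C A A" and "Zero C A A \<in> homset C A A"
    using assms by simp_all
  ultimately show "Ident C A = Zero C A A" by blast
next
  assume e: "Ident C A = Zero C A A"
  have "\<exists>!f. f \<in> homset C B A" if B: "B \<in> Obj C" for B
  proof (rule ex1I[of _ "Zero C B A"])
    show "Zero C B A \<in> homset C B A" using assms B by simp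
    fix f assume f: "f \<in> homset C B A"
    then have "Ident C A \<cdot> f = Zero C A A \<cdot> f" using e by simp
    then show "f = Zero C B A" using f assms by simp
  qed
  moreover have "\<exists>!f. f \<in> homset C A B" if B: "B \<in> Obj C" for B
  proof (rule ex1I[of _ "Zero C A B"])
    show "Zero C A B \<in> homset C A B" using assms B by simp
    fix f assume f: "f \<in> homset C A B"
    then have "f \<cdot> Ident C A = f \<cdot> Zero C A A" using e by simp
    then show "f = Zero C A B" using f assms by simp
  qed
  ultimately show "is_zero_object C A" using assms unfolding is_zero_object_def by blast
qed

lemma mono_zero_iff:
  assumes "is_mono C m"
  shows "m = Zero C (Dom C m) (Cod C m) \<longleftrightarrow> is_zero_object C (Dom C m)"
proof -
  have m: "m \<in> Arr C" using assms mono_Arr by blast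
  have "m = Zero C (Dom C m) (Cod C m) \<longleftrightarrow> Ident C (Dom C m) = Zero C (Dom C m) (Dom C m)"
  proof
    assume "m = Zero C (Dom C m) (Cod C m)"
    then have "m \<cdot> Ident C (Dom C m) = Zero C (Dom C m) (Cod C m)" using m by simp
    then show "Ident C (Dom C m) = Zero C (Dom C m) (Dom C m)"
      using mono_zeroD[OF assms, of "Ident C (Dom C m)" "Dom C m"] m by simp
  next
    assume "Ident C (Dom C m) = Zero C (Dom C m) (Dom C m)"
    then have "m = m \<cdot> Zero C (Dom C m) (Dom C m)" using m Comp_Ident_simps(2)[of m] by metis
    also have "\<dots> = Zero C (Dom C m) (Cod C m)" using m by simp
    finally show "m = Zero C (Dom C m) (Cod C m)" .
  qed
  then show ?thesis using is_zero_object_iff[of "Dom C m"] m by simp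
qed

text \<open>
  With \<open>a\<close> a section of \<open>e\<close>, the arrow \<open>1 - a e\<close> is killed by \<open>e\<close>, so it factors through the
  kernel of \<open>e\<close>; the factor is the projection that splits the kernel off.
\<close>

lemma split_epi_biproduct:
  assumes k: "is_kernel C k e" and e: "e \<in> homset C U B" and a: "a \<in> homset C B U"
    and ea: "e \<cdot> a = Ident C B"
  shows "\<exists>t. is_biproduct C (Dom C k) B U k a t e"
proof -
  have kA: "k \<in> Arr C" "Cod C k = U" and km: "is_mono C k"
    and ek: "e \<cdot> k = Zero C (Dom C k) B" using k e mono_Arr by (auto simp: is_kernel_iff)
  have [simp]: "U \<in> Obj C" "B \<in> Obj C" using e by auto
  have ae: "a \<cdot> e \<in> homset C U U" using a e by simp
  obtain n where n: "n \<in> homset C U U" and n1: "n \<boxplus> (a \<cdot> e) = Ident C U"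
    using difference_exists[OF _ ae, of "Ident C U"] by auto
  have "(e \<cdot> n) \<boxplus> (e \<cdot> (a \<cdot> e)) = e \<cdot> Ident C U"
    using Comp_Add_right[OF n ae e] n1 by simp
  then have "(e \<cdot> n) \<boxplus> e = e" using Comp_extend[OF ea] a e by simp
  then have "e \<cdot> n = Zero C U B" using Add_eq_right[of "e \<cdot> n" U B e] n e by simp
  then obtain t where t: "t \<in> homset C U (Dom C k)" and kt: "k \<cdot> t = n"
    using k n e unfolding is_kernel_iff by auto
  have "(n \<cdot> k) \<boxplus> ((a \<cdot> e) \<cdot> k) = Ident C U \<cdot> k"
    using Comp_Add_left[OF _ n ae, of k "Dom C k"] n1 kA by simp
  then have "Zero C (Dom C k) U \<boxplus> (n \<cdot> k) = k"
    using Add_simps(2)[of "n \<cdot> k" "Dom C k" U] ek kA a e n by simp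
  then have "n \<cdot> k = k" using Add_simps(3)[of "n \<cdot> k" "Dom C k" U] kA n by simp
  then have "k \<cdot> (t \<cdot> k) = k \<cdot> Ident C (Dom C k)" using kt[symmetric] t kA by simp
  then have tk: "t \<cdot> k = Ident C (Dom C k)" using mono_cancel[OF km, of "t \<cdot> k" "Dom C k"] t kA by simp
  have "(n \<cdot> a) \<boxplus> ((a \<cdot> e) \<cdot> a) = Ident C U \<cdot> a"
    using Comp_Add_left[OF a n ae] n1 by simp
  then have "(n \<cdot> a) \<boxplus> a = a" using ea a e by simp
  then have "n \<cdot> a = Zero C B U" using Add_eq_right[of "n \<cdot> a" B U a] n a by simp
  then have "t \<cdot> a = Zero C B (Dom C k)"
    using mono_zeroD[OF km, of "t \<cdot> a" B] kt[symmetric] t a kA by simp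
  then show ?thesis
    unfolding is_biproduct_def using t tk ek ea n1 kt kA e a by (intro exI[of _ t]) simp
qed

end

section \<open>Duality\<close>

definition opposite :: "('o, 'a, 'r) preadditive_cat_scheme \<Rightarrow> ('o, 'a) preadditive_cat"
  where "opposite C = \<lparr>Obj = Obj C, Arr = Arr C, Dom = Cod C, Cod = Dom C, Ident = Ident C,
    Comp = (\<lambda>g f. Comp C f g), Add = Add C, Zero = (\<lambda>A B. Zero C B A)\<rparr>"

lemma opposite_simps [simp]:
  "Obj (opposite C) = Obj C" "Arr (opposite C) = Arr C"
  "Dom (opposite C) = Cod C" "Cod (opposite C) = Dom C" "Ident (opposite C) = Ident C"
  "Comp (opposite C) g f = Comp C f g" "Add (opposite C) = Add C"
  "Zero (opposite C) A B = Zero C B A"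
  by (simp_all add: opposite_def)

lemma homset_opposite: "homset (opposite C) A B = homset C B A"
  by auto

lemma is_mono_opposite [simp]: "is_mono (opposite C) = is_epi C"
  by (auto simp: is_mono_def is_epi_def fun_eq_iff)

lemma is_epi_opposite [simp]: "is_epi (opposite C) = is_mono C"
  by (auto simp: is_mono_def is_epi_def fun_eq_iff)

lemma is_kernel_opposite [simp]: "is_kernel (opposite C) = is_cokernel C"
  by (simp add: is_kernel_def is_cokernel_def fun_eq_iff conj_ac)

lemma is_cokernel_opposite [simp]: "is_cokernel (opposite C) = is_kernel C"
  by (simp add: is_kernel_def is_cokernel_def fun_eq_iff conj_ac)

lemma is_biproduct_opposite [simp]:
  "is_biproduct (opposite C) A B S i j p q = is_biproduct C A B S p q i j"
  by (auto simp: is_biproduct_def)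

lemma is_zero_object_opposite [simp]: "is_zero_object (opposite C) = is_zero_object C"
  unfolding is_zero_object_def homset_opposite by (auto simp: fun_eq_iff)

lemma direct_summand_opposite:
  assumes "direct_summand C U M"
  shows "direct_summand (opposite C) U M"
proof -
  obtain u V v p q where "u \<in> homset C U M" "is_biproduct C U V M u v p q"
    using assms unfolding direct_summand_def summand_inclusion_def by auto
  then have "p \<in> homset (opposite C) U M" "is_biproduct (opposite C) U V M p q u v"
    by (auto simp: is_biproduct_def)
  then show ?thesis unfolding direct_summand_def summand_inclusion_def by force
qed

lemma (in category) category_opposite: "category (opposite C)"
proof
  fix f g h A B D E assume "f \<in> homset (opposite C) A B" "g \<in> homset (opposite C) B D"
    "h \<in> homset (opposite C) D E"
  then show "Comp (opposite C) (Comp (opposite C) h g) f =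
      Comp (opposite C) h (Comp (opposite C) g f)" by simp
qed auto

context preadditive_category
begin

lemma preadditive_category_opposite: "preadditive_category (opposite C)"
proof (intro preadditive_category.intro preadditive_category_axioms.intro category_opposite)
  fix A B assume "A \<in> Obj (opposite C)" "B \<in> Obj (opposite C)"
  moreover have "hom_group (opposite C) A B = hom_group C B A"
    by (simp add: hom_group_def homset_opposite del: homset_def)
  ultimately show "comm_group (hom_group (opposite C) A B)"
    using comm_group_hom[of B A] by simp
next
  fix f g h A B D assume "f \<in> homset (opposite C) A B" "g \<in> homset (opposite C) B D"
    "h \<in> homset (opposite C) B D"
  then show "Comp (opposite C) (Add (opposite C) g h) f =
      Add (opposite C) (Comp (opposite C) g f) (Comp (opposite C) h f)"
    using Comp_Add_right[of g D B h f A] by simp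
next
  fix f g h A B D assume "f \<in> homset (opposite C) A B" "g \<in> homset (opposite C) A B"
    "h \<in> homset (opposite C) B D"
  then show "Comp (opposite C) h (Add (opposite C) f g) =
      Add (opposite C) (Comp (opposite C) h f) (Comp (opposite C) h g)"
    using Comp_Add_left[of h D B f A g] by simp
qed

lemma is_cokernel_iff:
  "is_cokernel C c f \<longleftrightarrow> f \<in> Arr C \<and> is_epi C c \<and> Dom C c = Cod C f \<and>
     c \<cdot> f = Zero C (Dom C f) (Cod C c) \<and>
     (\<forall>B. \<forall>h \<in> homset C (Cod C f) B. h \<cdot> f = Zero C (Dom C f) B \<longrightarrow>
       (\<exists>u \<in> homset C (Cod C c) B. u \<cdot> c = h))"
  using preadditive_category.is_kernel_iff[OF preadditive_category_opposite, of c f]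
  unfolding homset_opposite by simp

lemma cokernel_factor:
  assumes "is_cokernel C c f" and "h \<in> homset C (Cod C f) B" and "h \<cdot> f = Zero C (Dom C f) B"
  shows "\<exists>u \<in> homset C (Cod C c) B. u \<cdot> c = h"
  using assms unfolding is_cokernel_iff by blast

lemma epi_cancel:
  assumes "is_epi C e" and "g \<in> homset C (Cod C e) B" and "h \<in> homset C (Cod C e) B"
    and "g \<cdot> e = h \<cdot> e"
  shows "g = h"
  using assms unfolding is_epi_def by blast

lemma epi_Arr: "is_epi C e \<Longrightarrow> e \<in> Arr C"
  by (simp add: is_epi_def)

lemma epi_of_Comp_epi:
  assumes "is_epi C (e \<cdot> d)" and "e \<in> Arr C" and "d \<in> Arr C" and "Cod C d = Dom C e"
  shows "is_epi C e"
  using category.mono_of_Comp_mono[OF category_opposite, of d e] assms by simp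

lemma split_epi:
  assumes "u \<in> homset C U M" and "r \<in> homset C M U" and "r \<cdot> u = Ident C U"
  shows "is_epi C r"
  using category.split_mono[OF category_opposite, of r U M u] assms by simp

lemma epi_zeroD:
  assumes "is_epi C e" and "g \<in> homset C (Cod C e) B" and "g \<cdot> e = Zero C (Dom C e) B"
  shows "g = Zero C (Cod C e) B"
  using preadditive_category.mono_zeroD[OF preadditive_category_opposite, of e g B] assms by simp

lemma epi_zeroI:
  assumes "e \<in> Arr C"
    and "\<And>B g. \<lbrakk>g \<in> homset C (Cod C e) B; g \<cdot> e = Zero C (Dom C e) B\<rbrakk> \<Longrightarrow> g = Zero C (Cod C e) B"
  shows "is_epi C e"
  using preadditive_category.mono_zeroI[OF preadditive_category_opposite, of e] assms by simp

end

context abelian_category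
begin

lemma abelian_category_opposite: "abelian_category (opposite C)"
proof (intro abelian_category.intro abelian_category_axioms.intro preadditive_category_opposite)
  fix A B assume "A \<in> Obj (opposite C)" "B \<in> Obj (opposite C)"
  then obtain S i j p q where "is_biproduct C A B S i j p q"
    using biproduct_exists[of A B] by auto
  then have "is_biproduct (opposite C) A B S p q i j" by simp
  then show "\<exists>S i j p q. is_biproduct (opposite C) A B S i j p q" by blast
qed (simp_all add: zero_object_exists kernel_exists cokernel_exists mono_is_kernel epi_is_cokernel)

section \<open>Kernels, cokernels and biproducts in an abelian category\<close>

text \<open>
  The monomorphism \<open>m\<close> is the kernel of some \<open>f\<close>, and \<open>f\<close> factors through the cokernel \<open>c\<close>
  of \<open>m\<close>. So whatever \<open>c\<close> kills is killed by \<open>f\<close> and factors through \<open>m\<close>.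
\<close>

lemma mono_kernel_of_cokernel:
  assumes m: "is_mono C m" and c: "is_cokernel C c m"
  shows "is_kernel C m c"
proof -
  obtain f where f: "is_kernel C m f" using mono_is_kernel[OF m] by blast
  then have fA: "f \<in> Arr C" "Dom C f = Cod C m" and fm: "f \<cdot> m = Zero C (Dom C m) (Cod C f)"
    by (auto simp: is_kernel_iff)
  have cA: "c \<in> Arr C" "Dom C c = Cod C m" and cm: "c \<cdot> m = Zero C (Dom C m) (Cod C c)"
    using c by (auto simp: is_cokernel_def)
  obtain w where w: "w \<in> homset C (Cod C c) (Cod C f)" and wc: "w \<cdot> c = f"
    using cokernel_factor[OF c, of f "Cod C f"] fA fm by auto
  have "\<exists>u \<in> homset C A (Dom C m). m \<cdot> u = h"
    if h: "h \<in> homset C A (Dom C c)" and ch: "c \<cdot> h = Zero C A (Cod C c)" for A h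
  proof -
    have "f \<cdot> h = w \<cdot> (c \<cdot> h)" using Comp_extend[OF wc, of h] w h cA by simp
    also have "\<dots> = Zero C A (Cod C f)" using ch w h by auto
    finally show ?thesis using kernel_factor[OF f, of h A] h cA fA by simp
  qed
  then show ?thesis using m cA cm by (simp add: is_kernel_iff)
qed

lemma epi_cokernel_of_kernel:
  assumes "is_epi C e" and "is_kernel C k e"
  shows "is_cokernel C e k"
  using abelian_category.mono_kernel_of_cokernel[OF abelian_category_opposite, of e k] assms
  by simp

text \<open>A complement of a split subobject is the kernel of a retraction.\<close>

lemma summand_inclusion_iff:
  assumes "u \<in> homset C U M"
  shows "summand_inclusion C u M \<longleftrightarrow> (\<exists>r \<in> homset C M U. r \<cdot> u = Ident C U)"
proof
  assume "summand_inclusion C u M"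
  then show "\<exists>r \<in> homset C M U. r \<cdot> u = Ident C U"
    using assms unfolding summand_inclusion_def is_biproduct_def by auto
next
  assume "\<exists>r \<in> homset C M U. r \<cdot> u = Ident C U"
  then obtain r where r: "r \<in> homset C M U" and ru: "r \<cdot> u = Ident C U" by blast
  then obtain v where v: "is_kernel C v r" using kernel_exists by auto
  then obtain t where "is_biproduct C (Dom C v) U M v u t r"
    using split_epi_biproduct[OF v r assms ru] by blast
  then have "is_biproduct C U (Dom C v) M u v r t"
    using Add_simps(2)[of "v \<cdot> t" M M "u \<cdot> r"] unfolding is_biproduct_def by auto
  then show "summand_inclusion C u M" using assms unfolding summand_inclusion_def by auto
qed

text \<open>
  The last clause replaces the uniqueness of the arrow with components \<open>a\<close> and \<open>b\<close> into their
  biproduct: its kernel is the intersection of the kernels of \<open>a\<close> and \<open>b\<close>.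
\<close>

lemma pairing_exists:
  assumes a: "a \<in> homset C U A" and b: "b \<in> homset C U B"
  shows "\<exists>S. \<exists>p \<in> homset C S A. \<exists>q \<in> homset C S B. \<exists>x \<in> homset C U S. p \<cdot> x = a \<and> q \<cdot> x = b \<and>
    (\<forall>W. \<forall>g \<in> homset C W U. a \<cdot> g = Zero C W A \<and> b \<cdot> g = Zero C W B \<longrightarrow> x \<cdot> g = Zero C W S)"
proof -
  have "A \<in> Obj C" "B \<in> Obj C" using a b by auto
  then obtain S i j p q where S: "is_biproduct C A B S i j p q" using biproduct_exists by blast
  then have i: "i \<in> homset C A S" and j: "j \<in> homset C B S" and p: "p \<in> homset C S A"
    and q: "q \<in> homset C S B" and eqs: "p \<cdot> i = Ident C A" "q \<cdot> j = Ident C B"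
    "q \<cdot> i = Zero C A B" "p \<cdot> j = Zero C B A"
    unfolding is_biproduct_def by auto
  define x where "x = (i \<cdot> a) \<boxplus> (j \<cdot> b)"
  have ia: "i \<cdot> a \<in> homset C U S" and jb: "j \<cdot> b \<in> homset C U S" using i j a b by auto
  have x: "x \<in> homset C U S" unfolding x_def by (rule Add_simps(1)[OF ia jb])
  have U: "U \<in> Obj C" using a by auto
  have "p \<cdot> x = (p \<cdot> (i \<cdot> a)) \<boxplus> (p \<cdot> (j \<cdot> b))" unfolding x_def by (rule Comp_Add_right[OF ia jb p])
  also have "\<dots> = a \<boxplus> Zero C U A"
    using Comp_extend[OF eqs(1), of a] Comp_extend[OF eqs(4), of b] i j p a b by auto
  also have "\<dots> = a" using Add_simps(2)[of a U A "Zero C U A"] Add_simps(3)[OF a a] a U by auto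
  finally have px: "p \<cdot> x = a" .
  have "q \<cdot> x = (q \<cdot> (i \<cdot> a)) \<boxplus> (q \<cdot> (j \<cdot> b))" unfolding x_def by (rule Comp_Add_right[OF ia jb q])
  also have "\<dots> = Zero C U B \<boxplus> b"
    using Comp_extend[OF eqs(2), of b] Comp_extend[OF eqs(3), of a] i j q a b by auto
  also have "\<dots> = b" using Add_simps(3)[OF b b] .
  finally have qx: "q \<cdot> x = b" .
  have "x \<cdot> g = Zero C W S"
    if g: "g \<in> homset C W U" and ag: "a \<cdot> g = Zero C W A" and bg: "b \<cdot> g = Zero C W B" for W g
  proof -
    have z: "Zero C W S \<in> homset C W S" using g i by auto
    have "x \<cdot> g = ((i \<cdot> a) \<cdot> g) \<boxplus> ((j \<cdot> b) \<cdot> g)"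
      unfolding x_def by (rule Comp_Add_left[OF g ia jb])
    also have "\<dots> = Zero C W S \<boxplus> Zero C W S" using ag bg g i j a b by auto
    finally show ?thesis using Add_simps(3)[OF z z] by simp
  qed
  then show ?thesis using p q x px qx by blast
qed

end

section \<open>Essential and superfluous subobjects without lattice operations\<close>

text \<open>
  For a monomorphism \<open>j\<close> the first condition is essentiality, with arbitrary arrows out of the
  ambient object in place of its subobjects (their kernels). The second is its dual, and
  for a cokernel \<open>q\<close> of \<open>v\<close> it says that \<open>v\<close> is superfluous. In this form the two notions are
  literally interchanged by passing to the opposite category, unlike meets and joins of subobjects.
\<close>

definition reflects_mono :: "('o, 'a, 'r) preadditive_cat_scheme \<Rightarrow> 'a \<Rightarrow> bool"
  where "reflects_mono C j \<longleftrightarrow>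
    (\<forall>B. \<forall>x \<in> homset C (Cod C j) B. is_mono C (Comp C x j) \<longrightarrow> is_mono C x)"

definition reflects_epi :: "('o, 'a, 'r) preadditive_cat_scheme \<Rightarrow> 'a \<Rightarrow> bool"
  where "reflects_epi C q \<longleftrightarrow>
    (\<forall>A. \<forall>x \<in> homset C A (Dom C q). is_epi C (Comp C q x) \<longrightarrow> is_epi C x)"

lemma reflects_mono_opposite [simp]: "reflects_mono (opposite C) = reflects_epi C"
  unfolding reflects_mono_def reflects_epi_def homset_opposite fun_eq_iff by simp

lemma reflects_monoD:
  "\<lbrakk>reflects_mono C j; x \<in> homset C (Cod C j) B; is_mono C (Comp C x j)\<rbrakk> \<Longrightarrow> is_mono C x"
  unfolding reflects_mono_def by blast

lemma reflects_epiD: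
  "\<lbrakk>reflects_epi C q; x \<in> homset C A (Dom C q); is_epi C (Comp C q x)\<rbrakk> \<Longrightarrow> is_epi C x"
  unfolding reflects_epi_def by blast

context abelian_category
begin

lemma kernel_zero_imp_mono:
  assumes n: "is_kernel C n f" and z: "is_zero_object C (Dom C n)"
  shows "is_mono C f"
proof (rule mono_zeroI)
  show f: "f \<in> Arr C" using n by (simp add: is_kernel_iff)
  have nm: "is_mono C n" and nA: "n \<in> Arr C" "Cod C n = Dom C f"
    using n mono_Arr by (auto simp: is_kernel_iff)
  have n0: "n = Zero C (Dom C n) (Cod C n)" using mono_zero_iff[OF nm] z by blast
  fix A g assume g: "g \<in> homset C A (Dom C f)" and fg: "f \<cdot> g = Zero C A (Cod C f)"
  obtain u where u: "u \<in> homset C A (Dom C n)" and nu: "n \<cdot> u = g"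
    using kernel_factor[OF n g fg] by blast
  have "Zero C (Dom C n) (Cod C n) \<cdot> u = Zero C A (Dom C f)"
    using u nA f by auto
  then show "g = Zero C A (Dom C f)" using n0 nu by metis
qed

lemma zero_object_of_sub_le:
  assumes n: "is_mono C n" and nm: "sub_le C n m" and m: "m \<in> Arr C"
    and z: "is_zero_object C (Dom C m)"
  shows "is_zero_object C (Dom C n)"
proof -
  have nA: "n \<in> Arr C" using n mono_Arr by blast
  obtain u where u: "u \<in> homset C (Dom C n) (Dom C m)" and mu: "m \<cdot> u = n"
    using nm unfolding sub_le_def by blast
  have "Ident C (Dom C m) \<cdot> u = Zero C (Dom C m) (Dom C m) \<cdot> u"
    using is_zero_object_iff[of "Dom C m"] z m by simp
  then have "u = Zero C (Dom C n) (Dom C m)" using u m nA by auto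
  then have "m \<cdot> Zero C (Dom C n) (Dom C m) = n" using mu by simp
  then have "n = Zero C (Dom C n) (Cod C n)"
    using m nA by (metis Comp_Zero Dom_in_Obj Zero_simps(3) Cod_in_Obj)
  then show ?thesis using mono_zero_iff[OF n] by blast
qed

text \<open>
  A subobject \<open>x\<close> is the kernel of its cokernel \<open>c\<close>, so \<open>k \<inter> x = 0\<close> means that \<open>c \<cdot> k\<close> is a
  monomorphism and \<open>x = 0\<close> means that \<open>c\<close> is one. Conversely an arrow \<open>x\<close> is tested on
  its kernel.
\<close>

lemma essential_iff:
  "essential C k L \<longleftrightarrow> is_subobject C k L \<and> reflects_mono C k"
proof
  assume ess: "essential C k L"
  then have km: "is_mono C k" and kA: "k \<in> Arr C" "Cod C k = L"
    using mono_Arr by (auto simp: essential_def is_subobject_def)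
  have "is_mono C x" if x: "x \<in> homset C L B" and xk: "is_mono C (x \<cdot> k)" for x B
  proof -
    obtain n where n: "is_kernel C n x" using kernel_exists x by auto
    then have nm: "is_mono C n" and nA: "n \<in> Arr C" "Cod C n = L"
      and xn: "x \<cdot> n = Zero C (Dom C n) B"
      using x mono_Arr by (auto simp: is_kernel_iff)
    \<comment> \<open>The zero subobject of \<open>L\<close> is the intersection of \<open>k\<close> with the kernel of \<open>x\<close>.\<close>
    obtain Z where Z: "is_zero_object C Z" using zero_object_exists by blast
    then have ZO: "Z \<in> Obj C" by (simp add: is_zero_object_def)
    have LO: "L \<in> Obj C" using kA by auto
    let ?m = "Zero C Z L"
    have IZ: "Ident C Z = Zero C Z Z" using Z ZO is_zero_object_iff by blast
    have mm: "is_mono C ?m"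
    proof (rule mono_zeroI)
      fix A g assume g: "g \<in> homset C A (Dom C ?m)"
      then have "Ident C Z \<cdot> g = Zero C A (Dom C ?m)" unfolding IZ using ZO LO by auto
      then show "g = Zero C A (Dom C ?m)" using g ZO LO by simp
    qed (use ZO LO in simp)
    have le: "sub_le C ?m y" if y: "y \<in> Arr C" "Cod C y = L" for y
    proof -
      have "Zero C Z (Dom C y) \<in> homset C (Dom C ?m) (Dom C y)" using y ZO LO by simp
      moreover have "y \<cdot> Zero C Z (Dom C y) = ?m" using y ZO by simp
      ultimately show ?thesis unfolding sub_le_def by blast
    qed
    have "sub_le C y ?m" if y: "is_subobject C y L" "sub_le C y k" "sub_le C y n" for y
    proof -
      have ym: "is_mono C y" and yA: "y \<in> Arr C" "Cod C y = L"
        using y mono_Arr by (auto simp: is_subobject_def)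
      obtain a b where a: "a \<in> homset C (Dom C y) (Dom C k)" and ka: "k \<cdot> a = y"
        and b: "b \<in> homset C (Dom C y) (Dom C n)" and nb: "n \<cdot> b = y"
        using y unfolding sub_le_def by blast
      have "(x \<cdot> k) \<cdot> a = x \<cdot> (k \<cdot> a)" using x kA a by simp
      also have "\<dots> = x \<cdot> (n \<cdot> b)" using ka nb by simp
      also have "\<dots> = Zero C (Dom C y) B" using Comp_extend[OF xn, of b] x nA b by auto
      finally have "a = Zero C (Dom C y) (Dom C k)"
        using mono_zeroD[OF xk, of a "Dom C y"] a x kA by simp
      then have "k \<cdot> Zero C (Dom C y) (Dom C k) = y" using ka by simp
      moreover have "k \<cdot> Zero C (Dom C y) (Dom C k) = Zero C (Dom C y) L"
        using kA yA by simp
      ultimately have "Zero C (Dom C y) L = y" by simp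
      moreover have "?m \<cdot> Zero C (Dom C y) Z = Zero C (Dom C y) L" using yA ZO LO by simp
      ultimately have "?m \<cdot> Zero C (Dom C y) Z = y" by simp
      moreover have "Zero C (Dom C y) Z \<in> homset C (Dom C y) (Dom C ?m)" using yA ZO LO by simp
      ultimately show ?thesis unfolding sub_le_def by blast
    qed
    then have "is_intersection C L k n ?m"
      unfolding is_intersection_def is_subobject_def using mm le kA nA ZO LO by simp
    moreover have "is_zero_object C (Dom C ?m)" using Z ZO LO by simp
    ultimately have "is_zero_object C (Dom C n)"
      using ess nm nA unfolding essential_def is_subobject_def by blast
    then show "is_mono C x" using kernel_zero_imp_mono n by blast
  qed
  then show "is_subobject C k L \<and> reflects_mono C k"
    using km kA unfolding is_subobject_def reflects_mono_def by blast
next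
  assume R: "is_subobject C k L \<and> reflects_mono C k"
  then have km: "is_mono C k" and kA: "k \<in> Arr C" "Cod C k = L" and refl: "reflects_mono C k"
    using mono_Arr by (auto simp: is_subobject_def)
  have "is_zero_object C (Dom C x)"
    if x: "is_subobject C x L" and m: "is_intersection C L k x m" and z: "is_zero_object C (Dom C m)"
    for x m
  proof -
    have xm: "is_mono C x" and xA: "x \<in> Arr C" "Cod C x = L"
      using x mono_Arr by (auto simp: is_subobject_def)
    have mA: "m \<in> Arr C" using m mono_Arr unfolding is_intersection_def is_subobject_def by blast
    obtain c where c: "is_cokernel C c x" using cokernel_exists xA by blast
    then have cA: "c \<in> Arr C" "Dom C c = L" and cx: "c \<cdot> x = Zero C (Dom C x) (Cod C c)"
      using xA by (auto simp: is_cokernel_def)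
    have xc: "is_kernel C x c" using mono_kernel_of_cokernel[OF xm c] .
    obtain n where n: "is_kernel C n (c \<cdot> k)" using kernel_exists[of "c \<cdot> k"] cA kA by auto
    then have nm: "is_mono C n" and nA: "n \<in> Arr C" "Cod C n = Dom C k"
      and ckn: "(c \<cdot> k) \<cdot> n = Zero C (Dom C n) (Cod C c)"
      using cA kA mono_Arr by (auto simp: is_kernel_iff)
    have knm: "is_mono C (k \<cdot> n)" using mono_Comp[OF km nm] nA by simp
    have "\<exists>h \<in> homset C (Dom C n) (Dom C x). x \<cdot> h = k \<cdot> n"
      using kernel_factor[OF xc, of "k \<cdot> n" "Dom C n"] ckn cA kA nA by simp
    then have "sub_le C (k \<cdot> n) x" unfolding sub_le_def using kA nA by simp
    moreover have "sub_le C (k \<cdot> n) k" unfolding sub_le_def using kA nA by auto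
    ultimately have "sub_le C (k \<cdot> n) m"
      using m knm kA nA unfolding is_intersection_def is_subobject_def by simp
    then have "is_zero_object C (Dom C n)"
      using zero_object_of_sub_le[OF knm _ mA z] kA nA by simp
    then have "is_mono C (c \<cdot> k)" using kernel_zero_imp_mono n by blast
    then have "is_mono C c" using reflects_monoD[OF refl, of c "Cod C c"] cA kA by simp
    then have x0: "x = Zero C (Dom C x) (Dom C c)"
      using mono_zeroD[of c x "Dom C x"] cx xA cA by simp
    then have "x = Zero C (Dom C x) (Cod C x)" using xA cA by simp
    then show ?thesis using mono_zero_iff[OF xm] by blast
  qed
  then show "essential C k L" unfolding essential_def using R by blast
qed

text \<open>In an abelian category an arrow that is both mono and epi is invertible.\<close>

lemma sub_eq_Ident_iff:
  assumes x: "is_subobject C x L"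
  shows "sub_eq C x (Ident C L) \<longleftrightarrow> is_epi C x"
proof
  have xm: "is_mono C x" and xA: "x \<in> Arr C" "Cod C x = L"
    using x mono_Arr by (auto simp: is_subobject_def)
  have LO: "L \<in> Obj C" using xA by auto
  {
    assume "sub_eq C x (Ident C L)"
    then obtain u where "u \<in> homset C L (Dom C x)" "x \<cdot> u = Ident C L"
      unfolding sub_eq_def sub_le_def using LO by auto
    then show "is_epi C x" using split_epi[of u L "Dom C x" x] xA by simp
  next
    assume e: "is_epi C x"
    obtain c where c: "is_cokernel C c x" using cokernel_exists xA by blast
    then have cA: "c \<in> Arr C" "Dom C c = L" and cx: "c \<cdot> x = Zero C (Dom C x) (Cod C c)"
      using xA by (auto simp: is_cokernel_def)
    have xc: "is_kernel C x c" using mono_kernel_of_cokernel[OF xm c] .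
    have "c = Zero C L (Cod C c)" using epi_zeroD[OF e, of c "Cod C c"] cA cx xA by simp
    then have "c \<cdot> Ident C L = Zero C L (Cod C c)" using cA by simp
    then obtain u where "u \<in> homset C L (Dom C x)" "x \<cdot> u = Ident C L"
      using kernel_factor[OF xc, of "Ident C L" L] cA LO by auto
    moreover have "Ident C L \<cdot> x = x" using xA by simp
    ultimately show "sub_eq C x (Ident C L)"
      unfolding sub_eq_def sub_le_def using LO xA by auto
  }
qed

text \<open>
  If \<open>h \<cdot> q \<cdot> x = 0\<close>, then \<open>h \<cdot> q\<close> vanishes on both \<open>v\<close> and \<open>x\<close>, so its kernel contains their sum.
  Conversely every subobject containing \<open>v\<close> and \<open>x\<close> is the kernel of an arrow that vanishes on
  \<open>v\<close>, hence has the form \<open>h \<cdot> q\<close>, and satisfies \<open>h \<cdot> q \<cdot> x = 0\<close>.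
\<close>

lemma sum_eq_Ident_iff:
  assumes v: "is_subobject C v L" and x: "is_subobject C x L" and q: "is_cokernel C q v"
  shows "(\<exists>s. is_sum C L v x s \<and> sub_eq C s (Ident C L)) \<longleftrightarrow> is_epi C (q \<cdot> x)"
proof
  have vA: "v \<in> Arr C" "Cod C v = L" and xA: "x \<in> Arr C" "Cod C x = L"
    using v x mono_Arr by (auto simp: is_subobject_def)
  have qe: "is_epi C q" and qA: "q \<in> Arr C" "Dom C q = L"
    and qv: "q \<cdot> v = Zero C (Dom C v) (Cod C q)"
    using q vA epi_Arr by (auto simp: is_cokernel_iff)
  have LO: "L \<in> Obj C" using xA by auto
  {
    assume "\<exists>s. is_sum C L v x s \<and> sub_eq C s (Ident C L)"
    then obtain s where s: "is_sum C L v x s" and si: "sub_eq C s (Ident C L)" by blast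
    have ss: "is_subobject C s L" using s unfolding is_sum_def by blast
    then have se: "is_epi C s" using sub_eq_Ident_iff si by blast
    have sA: "s \<in> Arr C" "Cod C s = L" using ss mono_Arr by (auto simp: is_subobject_def)
    show "is_epi C (q \<cdot> x)"
    proof (rule epi_zeroI)
      show "q \<cdot> x \<in> Arr C" using qA xA by simp
      fix B h
      assume h: "h \<in> homset C (Cod C (q \<cdot> x)) B" and hqx: "h \<cdot> (q \<cdot> x) = Zero C (Dom C (q \<cdot> x)) B"
      then have hA: "h \<in> Arr C" "Dom C h = Cod C q" "Cod C h = B" using qA xA by auto
      have BO: "B \<in> Obj C" using hA by auto
      obtain n where n: "is_kernel C n (h \<cdot> q)" using kernel_exists[of "h \<cdot> q"] hA qA by auto
      then have nm: "is_mono C n" and nA: "n \<in> Arr C" "Cod C n = L"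
        and hqn: "(h \<cdot> q) \<cdot> n = Zero C (Dom C n) B"
        using hA qA mono_Arr by (auto simp: is_kernel_iff)
      have "(h \<cdot> q) \<cdot> v = Zero C (Dom C v) B" using qv hA qA vA by simp
      then have "sub_le C v n"
        unfolding sub_le_def using kernel_factor[OF n, of v "Dom C v"] hA qA vA by simp
      moreover have "sub_le C x n"
        unfolding sub_le_def using kernel_factor[OF n, of x "Dom C x"] hqx hA qA xA by simp
      ultimately have "sub_le C s n"
        using s nm nA unfolding is_sum_def is_subobject_def by blast
      then obtain u where u: "u \<in> homset C (Dom C s) (Dom C n)" and nu: "n \<cdot> u = s"
        unfolding sub_le_def by blast
      have "(h \<cdot> q) \<cdot> (n \<cdot> u) = Zero C (Dom C s) B"
        using Comp_extend[OF hqn, of u] u nA hA qA BO by auto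
      then have "h \<cdot> q = Zero C L B"
        using epi_zeroD[OF se, of "h \<cdot> q" B] nu sA hA qA by simp
      then show "h = Zero C (Cod C (q \<cdot> x)) B" using epi_zeroD[OF qe, of h B] hA qA xA by simp
    qed
  next
    assume e: "is_epi C (q \<cdot> x)"
    have "sub_le C (Ident C L) n"
      if n: "is_subobject C n L" and vn: "sub_le C v n" and xn: "sub_le C x n" for n
    proof -
      have nm: "is_mono C n" and nA: "n \<in> Arr C" "Cod C n = L"
        using n mono_Arr by (auto simp: is_subobject_def)
      obtain c where c: "is_cokernel C c n" using cokernel_exists nA by blast
      then have cA: "c \<in> Arr C" "Dom C c = L" and cn: "c \<cdot> n = Zero C (Dom C n) (Cod C c)"
        using nA by (auto simp: is_cokernel_def)
      obtain a b where a: "a \<in> homset C (Dom C v) (Dom C n)" and na: "n \<cdot> a = v"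
        and b: "b \<in> homset C (Dom C x) (Dom C n)" and nb: "n \<cdot> b = x"
        using vn xn unfolding sub_le_def by blast
      have "c \<cdot> (n \<cdot> a) = Zero C (Dom C v) (Cod C c)"
        using Comp_extend[OF cn, of a] cA nA a by auto
      then obtain h where h: "h \<in> homset C (Cod C q) (Cod C c)" and hq: "h \<cdot> q = c"
        using cokernel_factor[OF q, of c "Cod C c"] na cA vA by auto
      have "c \<cdot> (n \<cdot> b) = Zero C (Dom C x) (Cod C c)"
        using Comp_extend[OF cn, of b] cA nA b by auto
      then have "h \<cdot> (q \<cdot> x) = Zero C (Dom C x) (Cod C c)"
        using Comp_extend[OF hq, of x] nb h qA xA by simp
      then have "h = Zero C (Cod C q) (Cod C c)"
        using epi_zeroD[OF e, of h "Cod C c"] h qA xA by simp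
      then have "c = Zero C (Cod C q) (Cod C c) \<cdot> q" using hq by simp
      then have "c = Zero C L (Cod C c)" using qA cA by simp
      then have "c \<cdot> Ident C L = Zero C L (Cod C c)" using cA by simp
      then show ?thesis
        using kernel_factor[OF mono_kernel_of_cokernel[OF nm c], of "Ident C L" L] cA LO
        unfolding sub_le_def by simp
    qed
    moreover have "is_subobject C (Ident C L) L"
      unfolding is_subobject_def is_mono_def using LO by simp
    moreover have "sub_le C y (Ident C L)" if "y \<in> Arr C" "Cod C y = L" for y
      unfolding sub_le_def using that LO by auto
    ultimately have "is_sum C L v x (Ident C L)" "sub_eq C (Ident C L) (Ident C L)"
      unfolding is_sum_def sub_eq_def using vA xA LO by auto
    then show "\<exists>s. is_sum C L v x s \<and> sub_eq C s (Ident C L)" by blast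
  }
qed

text \<open>
  An arrow into \<open>L\<close> may be replaced by its image, since an arrow is epi as soon as
  its image is.
\<close>

lemma superfluous_iff:
  assumes v: "is_subobject C v L" and q: "is_cokernel C q v"
  shows "superfluous C v L \<longleftrightarrow> reflects_epi C q"
proof -
  have vA: "v \<in> Arr C" "Cod C v = L" using v mono_Arr by (auto simp: is_subobject_def)
  have qA: "q \<in> Arr C" "Dom C q = L" using q vA by (auto simp: is_cokernel_def)
  have "superfluous C v L \<longleftrightarrow> (\<forall>x. is_subobject C x L \<longrightarrow> is_epi C (q \<cdot> x) \<longrightarrow> is_epi C x)"
    unfolding superfluous_def using v sum_eq_Ident_iff[OF v _ q] sub_eq_Ident_iff by blast
  also have "\<dots> \<longleftrightarrow> reflects_epi C q"
  proof
    assume sub: "\<forall>x. is_subobject C x L \<longrightarrow> is_epi C (q \<cdot> x) \<longrightarrow> is_epi C x"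
    have "is_epi C x" if x: "x \<in> homset C A (Dom C q)" and qx: "is_epi C (q \<cdot> x)" for A x
    proof -
      have xA: "x \<in> Arr C" "Cod C x = L" "Dom C x = A" using x qA by auto
      obtain c where c: "is_cokernel C c x" using cokernel_exists xA by blast
      then have cA: "c \<in> Arr C" "Dom C c = L" and cx: "c \<cdot> x = Zero C A (Cod C c)"
        using xA by (auto simp: is_cokernel_def)
      obtain m where m: "is_kernel C m c" using kernel_exists cA by blast
      then have mm: "is_mono C m" and mA: "m \<in> Arr C" "Cod C m = L"
        and cm: "c \<cdot> m = Zero C (Dom C m) (Cod C c)"
        using cA mono_Arr by (auto simp: is_kernel_iff)
      obtain y where y: "y \<in> homset C A (Dom C m)" and my: "m \<cdot> y = x"
        using kernel_factor[OF m, of x A] cx xA cA by auto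
      have "is_epi C ((q \<cdot> m) \<cdot> y)" using qx my y qA mA by simp
      then have "is_epi C (q \<cdot> m)" using epi_of_Comp_epi[of "q \<cdot> m" y] y qA mA by simp
      then have "is_epi C m" using sub mm mA by (simp add: is_subobject_def)
      then have c0: "c = Zero C L (Cod C c)"
        using epi_zeroD[of m c "Cod C c"] cm cA mA by simp
      show ?thesis
      proof (rule epi_zeroI)
        fix B h assume h: "h \<in> homset C (Cod C x) B" and hx: "h \<cdot> x = Zero C (Dom C x) B"
        obtain w where w: "w \<in> homset C (Cod C c) B" and wc: "w \<cdot> c = h"
          using cokernel_factor[OF c h hx] by blast
        have "w \<cdot> Zero C L (Cod C c) = Zero C L B" using w h xA by auto
        then have "w \<cdot> c = Zero C L B" using c0 by simp
        then show "h = Zero C (Cod C x) B" using wc xA by simp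
      qed (rule xA)
    qed
    then show "reflects_epi C q" unfolding reflects_epi_def by blast
  next
    assume r: "reflects_epi C q"
    show "\<forall>x. is_subobject C x L \<longrightarrow> is_epi C (q \<cdot> x) \<longrightarrow> is_epi C x"
    proof (intro allI impI)
      fix x assume "is_subobject C x L" and "is_epi C (q \<cdot> x)"
      then show "is_epi C x"
        using reflects_epiD[OF r, of x "Dom C x"] qA mono_Arr[of x] by (auto simp: is_subobject_def)
    qed
  qed
  finally show ?thesis .
qed

section \<open>The CS-Rickart conditions and their duality\<close>

text \<open>
  For \<open>j\<close> to be essential it must also be a monomorphism, but this is automatic, since
  \<open>u \<cdot> j\<close> is a kernel.
\<close>

lemma cs_rickart_iff:
  "cs_rickart C M N \<longleftrightarrow> (\<forall>f \<in> homset C M N. \<exists>k U u r j.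
     is_kernel C k f \<and> u \<in> homset C U M \<and> r \<in> homset C M U \<and> r \<cdot> u = Ident C U \<and>
     j \<in> homset C (Dom C k) U \<and> u \<cdot> j = k \<and> reflects_mono C j)"
  (is "_ \<longleftrightarrow> (\<forall>f \<in> _. ?R f)")
proof -
  have "(\<exists>k u j. is_kernel C k f \<and> summand_inclusion C u M \<and>
      j \<in> homset C (Dom C k) (Dom C u) \<and> u \<cdot> j = k \<and> essential C j (Dom C u)) \<longleftrightarrow> ?R f"
    (is "?L \<longleftrightarrow> _") for f
  proof
    assume ?L
    then obtain k u j where k: "is_kernel C k f" and u: "summand_inclusion C u M"
      and j: "j \<in> homset C (Dom C k) (Dom C u)" "u \<cdot> j = k" "essential C j (Dom C u)" by blast
    have u': "u \<in> homset C (Dom C u) M"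
      using u unfolding summand_inclusion_def is_biproduct_def by blast
    then obtain r where "r \<in> homset C M (Dom C u)" "r \<cdot> u = Ident C (Dom C u)"
      using u summand_inclusion_iff by blast
    moreover have "reflects_mono C j" using j(3) essential_iff by blast
    ultimately show "?R f" using k u' j(1,2) by blast
  next
    assume "?R f"
    then obtain k U u r j where k: "is_kernel C k f" and u: "u \<in> homset C U M"
      and r: "r \<in> homset C M U" "r \<cdot> u = Ident C U"
      and j: "j \<in> homset C (Dom C k) U" "u \<cdot> j = k" "reflects_mono C j" by blast
    have "is_mono C (u \<cdot> j)" using k j(2) is_kernel_iff by blast
    then have "is_mono C j" using mono_of_Comp_mono[of u j] u j by auto
    then have "essential C j U" using j essential_iff unfolding is_subobject_def by auto
    moreover have "summand_inclusion C u M" using summand_inclusion_iff[OF u] r by blast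
    moreover have "Dom C u = U" using u by simp
    ultimately show ?L using k j by blast
  qed
  then show ?thesis unfolding cs_rickart_def by blast
qed

text \<open>
  With \<open>m = ker c\<close> the image of \<open>f\<close> and \<open>k\<close> a summand of \<open>N\<close> contained in \<open>m\<close>, the quotient of \<open>N\<close> by
  \<open>m\<close> is reached through the complementary summand \<open>Q = N/K\<close> as \<open>c = q \<cdot> e\<close>, and \<open>q\<close> is
  the cokernel of \<open>m/k\<close>. So \<open>m/k\<close> is superfluous iff \<open>q\<close> reflects epimorphisms.
\<close>

lemma dual_cs_rickart_iff:
  "dual_cs_rickart C M N \<longleftrightarrow> (\<forall>f \<in> homset C M N. \<exists>c Q e s q.
     is_cokernel C c f \<and> e \<in> homset C N Q \<and> s \<in> homset C Q N \<and> e \<cdot> s = Ident C Q \<and>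
     q \<in> homset C Q (Cod C c) \<and> q \<cdot> e = c \<and> reflects_epi C q)"
  (is "_ \<longleftrightarrow> (\<forall>f \<in> _. ?R f)")
proof -
  have "(\<exists>m. is_image C m f \<and> lies_above_summand C m N) \<longleftrightarrow> ?R f" (is "?L \<longleftrightarrow> _")
    if f: "f \<in> homset C M N" for f
  proof
    assume ?L
    then obtain m c k j e d v where cf: "is_cokernel C c f" and m: "is_kernel C m c"
      and k: "summand_inclusion C k N" and j: "j \<in> homset C (Dom C k) (Dom C m)" "m \<cdot> j = k"
      and e: "is_cokernel C e k" and d: "is_cokernel C d j"
      and v: "v \<in> homset C (Cod C d) (Cod C e)" "v \<cdot> d = e \<cdot> m" and sup: "superfluous C v (Cod C e)"
      unfolding is_image_def lies_above_summand_def by blast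
    have cA: "c \<in> Arr C" "Dom C c = N" and ce: "is_epi C c"
      using cf f epi_Arr by (auto simp: is_cokernel_iff)
    have mA: "m \<in> Arr C" "Cod C m = N" and cm: "c \<cdot> m = Zero C (Dom C m) (Cod C c)"
      using m cA mono_Arr by (auto simp: is_kernel_iff)
    have kA: "k \<in> homset C (Dom C k) N"
      using k unfolding summand_inclusion_def is_biproduct_def by blast
    then have NO: "N \<in> Obj C" by auto
    obtain r where r: "r \<in> homset C N (Dom C k)" "r \<cdot> k = Ident C (Dom C k)"
      using k summand_inclusion_iff[OF kA] by blast
    have eA: "e \<in> Arr C" "Dom C e = N" and ee: "is_epi C e"
      and ek: "e \<cdot> k = Zero C (Dom C k) (Cod C e)"
      using e kA epi_Arr by (auto simp: is_cokernel_iff)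
    have dA: "d \<in> Arr C" "Dom C d = Dom C m" and de: "is_epi C d"
      and dj: "d \<cdot> j = Zero C (Dom C j) (Cod C d)"
      using d j epi_Arr by (auto simp: is_cokernel_iff)
    \<comment> \<open>The cokernel of a split monomorphism splits, by duality.\<close>
    obtain s where "is_biproduct (opposite C) (Cod C e) (Dom C k) N e r s k"
      using preadditive_category.split_epi_biproduct[OF preadditive_category_opposite,
          of e k N "Dom C k" r] e kA r by auto
    then have s: "s \<in> homset C (Cod C e) N" "e \<cdot> s = Ident C (Cod C e)"
      by (auto simp: is_biproduct_def)
    have "c \<cdot> (m \<cdot> j) = Zero C (Dom C k) (Cod C c)"
      using Comp_extend[OF cm, of j] cA mA j(1) by auto
    then obtain q where q: "q \<in> homset C (Cod C e) (Cod C c)" and qe: "q \<cdot> e = c"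
      using cokernel_factor[OF e, of c "Cod C c"] j(2) cA kA by auto
    have "is_cokernel C q v"
      unfolding is_cokernel_iff
    proof (intro conjI allI ballI impI)
      show "v \<in> Arr C" "Dom C q = Cod C v" using v q by auto
      show "is_epi C q" using epi_of_Comp_epi[of q e] q qe ce eA by simp
      have "(q \<cdot> v) \<cdot> d = Zero C (Dom C d) (Cod C c)"
        using v q dA cm Comp_extend[OF qe, of m] eA mA by simp
      then show "q \<cdot> v = Zero C (Dom C v) (Cod C q)"
        using epi_zeroD[OF de, of "q \<cdot> v" "Cod C c"] q v by simp
      fix B h assume "h \<in> homset C (Cod C v) B" and hv: "h \<cdot> v = Zero C (Dom C v) B"
      then have h: "h \<in> homset C (Cod C e) B" using v by simp
      have "(h \<cdot> e) \<cdot> m = (h \<cdot> v) \<cdot> d" using h v eA mA dA by simp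
      also have "\<dots> = Zero C (Dom C m) B" using hv h v dA by auto
      finally obtain w where w: "w \<in> homset C (Cod C c) B" and wc: "w \<cdot> c = h \<cdot> e"
        using cokernel_factor[OF epi_cokernel_of_kernel[OF ce m], of "h \<cdot> e" B] h eA mA by auto
      have "(w \<cdot> q) \<cdot> e = h \<cdot> e" using w q eA qe wc by simp
      then have "w \<cdot> q = h" using epi_cancel[OF ee, of "w \<cdot> q" B h] w q h by simp
      then show "\<exists>u \<in> homset C (Cod C q) B. u \<cdot> q = h" using w q by auto
    qed
    then have "reflects_epi C q"
      using superfluous_iff sup unfolding superfluous_def by blast
    moreover have "e \<in> homset C N (Cod C e)" using eA by simp
    ultimately show "?R f" using cf s q qe by blast
  next
    assume "?R f"
    then obtain c Q e s q where cf: "is_cokernel C c f" and e: "e \<in> homset C N Q"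
      and s: "s \<in> homset C Q N" and es: "e \<cdot> s = Ident C Q"
      and q: "q \<in> homset C Q (Cod C c)" and qe: "q \<cdot> e = c" and refl: "reflects_epi C q" by blast
    have cA: "c \<in> Arr C" "Dom C c = N" and ce: "is_epi C c"
      using cf f epi_Arr by (auto simp: is_cokernel_iff)
    have qepi: "is_epi C q" using epi_of_Comp_epi[of q e] q qe ce e by simp
    have ee: "is_epi C e" using split_epi[OF s e es] .
    obtain m where m: "is_kernel C m c" using kernel_exists cA by blast
    then have mm: "is_mono C m" and mA: "m \<in> Arr C" "Cod C m = N"
      and cm: "c \<cdot> m = Zero C (Dom C m) (Cod C c)"
      using cA mono_Arr by (auto simp: is_kernel_iff)
    obtain k where k: "is_kernel C k e" using kernel_exists e by auto
    then have km: "is_mono C k" and kA: "k \<in> Arr C" "Cod C k = N"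
      and ek: "e \<cdot> k = Zero C (Dom C k) Q"
      using e mono_Arr by (auto simp: is_kernel_iff)
    have ksum: "summand_inclusion C k N"
      using split_epi_biproduct[OF k e s es] unfolding summand_inclusion_def by blast
    have "c \<cdot> k = Zero C (Dom C k) (Cod C c)"
      using Comp_extend[OF qe, of k] ek q e kA by auto
    then obtain j where j: "j \<in> homset C (Dom C k) (Dom C m)" and mj: "m \<cdot> j = k"
      using kernel_factor[OF m, of k "Dom C k"] kA cA by auto
    obtain v where v: "is_kernel C v q" using kernel_exists q by auto
    then have vm: "is_mono C v" and vA: "v \<in> Arr C" "Cod C v = Q"
      and qv: "q \<cdot> v = Zero C (Dom C v) (Cod C c)"
      using q mono_Arr by (auto simp: is_kernel_iff)
    have "q \<cdot> (e \<cdot> m) = Zero C (Dom C m) (Cod C c)"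
      using Comp_extend[OF qe, of m] cm q e mA by simp
    then obtain d where d: "d \<in> homset C (Dom C m) (Dom C v)" and vd: "v \<cdot> d = e \<cdot> m"
      using kernel_factor[OF v, of "e \<cdot> m" "Dom C m"] q e mA by auto
    \<comment> \<open>The arrow \<open>d\<close> is a pullback of the split epimorphism \<open>e\<close>, so it splits too.\<close>
    have "c \<cdot> (s \<cdot> v) = (q \<cdot> (e \<cdot> s)) \<cdot> v"
      using Comp_extend[OF qe, of "s \<cdot> v"] q e s vA by simp
    also have "\<dots> = Zero C (Dom C v) (Cod C c)" using es q qv by simp
    finally obtain w where w: "w \<in> homset C (Dom C v) (Dom C m)" and mw: "m \<cdot> w = s \<cdot> v"
      using kernel_factor[OF m, of "s \<cdot> v" "Dom C v"] s vA cA by auto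
    have "v \<cdot> (d \<cdot> w) = e \<cdot> (s \<cdot> v)"
      using Comp_extend[OF vd, of w] mw d w e vA mA by simp
    also have "\<dots> = v" using Comp_extend[OF es, of v] e s vA by simp
    finally have "d \<cdot> w = Ident C (Dom C v)"
      using mono_cancel[OF vm, of "d \<cdot> w" "Dom C v" "Ident C (Dom C v)"] d w vA by simp
    then have de: "is_epi C d" using split_epi[OF w d] by blast
    have "is_kernel C j d"
      unfolding is_kernel_iff
    proof (intro conjI allI ballI impI)
      show "d \<in> Arr C" "Cod C j = Dom C d" using d j by auto
      show "is_mono C j" using mono_of_Comp_mono[of m j] km mj mA j by simp
      have "v \<cdot> (d \<cdot> j) = Zero C (Dom C k) Q"
        using Comp_extend[OF vd, of j] mj ek d j vA mA e by simp
      then show "d \<cdot> j = Zero C (Dom C j) (Cod C d)"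
        using mono_zeroD[OF vm, of "d \<cdot> j" "Dom C k"] d j vA by simp
      fix A h assume "h \<in> homset C A (Dom C d)" and dh: "d \<cdot> h = Zero C A (Cod C d)"
      then have h: "h \<in> homset C A (Dom C m)" using d by simp
      have "e \<cdot> (m \<cdot> h) = v \<cdot> (d \<cdot> h)" using Comp_extend[OF vd, of h] h d vA e mA by simp
      also have "\<dots> = Zero C A Q" using dh d h vA by auto
      finally obtain h' where h': "h' \<in> homset C A (Dom C k)" and kh': "k \<cdot> h' = m \<cdot> h"
        using kernel_factor[OF k, of "m \<cdot> h" A] h mA e by auto
      have "m \<cdot> (j \<cdot> h') = m \<cdot> h" using Comp_extend[OF mj, of h'] h' kh' j mA by simp
      then have "j \<cdot> h' = h" using mono_cancel[OF mm, of "j \<cdot> h'" A h] j h' h by simp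
      then show "\<exists>u \<in> homset C A (Dom C j). j \<cdot> u = h" using h' j by auto
    qed
    then have "is_cokernel C d j" using epi_cokernel_of_kernel[OF de] by blast
    moreover have "is_cokernel C e k" using epi_cokernel_of_kernel[OF ee k] .
    moreover have "is_cokernel C q v" using epi_cokernel_of_kernel[OF qepi v] .
    then have "superfluous C v (Cod C e)"
      using superfluous_iff[of v Q q] refl vm vA e by (simp add: is_subobject_def)
    moreover have "v \<in> homset C (Cod C d) (Cod C e)" using d e vA by simp
    ultimately have "lies_above_summand C m N"
      unfolding lies_above_summand_def is_subobject_def using ksum j mj vd mm mA by blast
    moreover have "is_image C m f" unfolding is_image_def using cf m by blast
    ultimately show ?L by blast
  qed
  then show ?thesis unfolding dual_cs_rickart_def by blast
qed

lemma dual_cs_rickart_iff_opposite: "dual_cs_rickart C M N \<longleftrightarrow> cs_rickart (opposite C) N M"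
  unfolding dual_cs_rickart_iff abelian_category.cs_rickart_iff[OF abelian_category_opposite]
    homset_opposite by simp

section \<open>Passing to direct summands\<close>

lemma direct_summandE:
  assumes "direct_summand C U M"
  obtains V i i' p p' where "is_biproduct C U V M i i' p p'"
  using assms unfolding direct_summand_def summand_inclusion_def by auto

text \<open>
  An arrow \<open>f : M' \<rightarrow> N'\<close> extends to \<open>g = i\<^sub>N f p : M \<rightarrow> N\<close> with \<open>Ker g = Ker f \<oplus> M''\<close>, where \<open>M = M' \<oplus> M''\<close>.
  If \<open>Ker g\<close> is essential in a summand \<open>U\<close> of \<open>M\<close>, then \<open>U\<close> contains \<open>M''\<close>, hence
  \<open>U = U' \<oplus> M''\<close> where \<open>U'\<close> is the kernel of the projection \<open>U \<rightarrow> M''\<close>. This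
  \<open>U'\<close> embeds as a summand of \<open>M'\<close>, and \<open>Ker f\<close> is essential in it.
\<close>

lemma cs_rickart_direct_summand:
  assumes cs: "cs_rickart C M N" and M': "direct_summand C M' M" and N': "direct_summand C N' N"
  shows "cs_rickart C M' N'"
  unfolding cs_rickart_iff
proof
  fix f assume f: "f \<in> homset C M' N'"
  obtain M'' i i'' p p'' where bM: "is_biproduct C M' M'' M i i'' p p''"
    using M' by (rule direct_summandE)
  then have i: "i \<in> homset C M' M" and i'': "i'' \<in> homset C M'' M" and p: "p \<in> homset C M M'"
    and p'': "p'' \<in> homset C M M''" and pi: "p \<cdot> i = Ident C M'" and pi'': "p'' \<cdot> i'' = Ident C M''"
    and p''i: "p'' \<cdot> i = Zero C M' M''" and p_i'': "p \<cdot> i'' = Zero C M'' M'"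
    and one: "(i \<cdot> p) \<boxplus> (i'' \<cdot> p'') = Ident C M"
    unfolding is_biproduct_def by auto
  obtain N'' n n'' s s'' where "is_biproduct C N' N'' N n n'' s s''"
    using N' by (rule direct_summandE)
  then have n: "n \<in> homset C N' N" and nm: "is_mono C n"
    using split_mono[of n N' N s] unfolding is_biproduct_def by auto
  have O: "M' \<in> Obj C" "M'' \<in> Obj C" "M \<in> Obj C" "N' \<in> Obj C" "N \<in> Obj C"
    using f i'' i n by auto
  define g where "g = n \<cdot> (f \<cdot> p)"
  have g: "g \<in> homset C M N" unfolding g_def using n f p by simp
  have gw: "g \<cdot> w = n \<cdot> (f \<cdot> (p \<cdot> w))" if "w \<in> Arr C" "Cod C w = M" for w
    unfolding g_def using n f p that by simp
  have gi: "g \<cdot> (i \<cdot> w) = n \<cdot> (f \<cdot> w)" if "w \<in> Arr C" "Cod C w = M'" for w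
    using gw[of "i \<cdot> w"] Comp_extend[OF pi, of w] i p that by simp
  obtain k U u r j where k: "is_kernel C k g" and u: "u \<in> homset C U M" and r: "r \<in> homset C M U"
    and ru: "r \<cdot> u = Ident C U" and j: "j \<in> homset C (Dom C k) U" and uj: "u \<cdot> j = k"
    and refl: "reflects_mono C j"
    using cs g unfolding cs_rickart_iff by blast
  have km: "is_mono C k" and kA: "k \<in> Arr C" "Cod C k = M" and gk: "g \<cdot> k = Zero C (Dom C k) N"
    using k g mono_Arr by (auto simp: is_kernel_iff)
  have um: "is_mono C u" using split_mono[OF u r ru] .
  have UO: "U \<in> Obj C" using u by auto
  \<comment> \<open>The summand \<open>M''\<close> lies in \<open>Ker g\<close>, hence in \<open>U\<close>, and \<open>a\<close> is its inclusion.\<close>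
  have "g \<cdot> i'' = Zero C M'' N" using gw[of i''] p_i'' i'' n f O by simp
  then obtain b where b: "b \<in> homset C M'' (Dom C k)" and kb: "k \<cdot> b = i''"
    using kernel_factor[OF k, of i'' M''] i'' g by auto
  define a where "a = j \<cdot> b"
  have a: "a \<in> homset C M'' U" unfolding a_def using j b by simp
  have ua: "u \<cdot> a = i''" unfolding a_def using Comp_extend[OF uj, of b] kb u j b by simp
  define e where "e = p'' \<cdot> u"
  have e: "e \<in> homset C U M''" unfolding e_def using p'' u by simp
  have ea: "e \<cdot> a = Ident C M''" unfolding e_def using ua pi'' p'' u a by simp
  have ew: "e \<cdot> w = p'' \<cdot> (u \<cdot> w)" if "w \<in> Arr C" "Cod C w = U" for w
    unfolding e_def using p'' u that by simp
  obtain u' where u': "is_kernel C u' e" using kernel_exists e by auto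
  define U' where "U' = Dom C u'"
  obtain t where "is_biproduct C U' M'' U u' a t e"
    using split_epi_biproduct[OF u' e a ea] U'_def by blast
  then have u'A: "u' \<in> homset C U' U" and t: "t \<in> homset C U U'" and tu': "t \<cdot> u' = Ident C U'"
    and eu': "e \<cdot> u' = Zero C U' M''"
    unfolding is_biproduct_def by auto
  have u'm: "is_mono C u'" using u' is_kernel_iff by blast
  have U'O: "U' \<in> Obj C" using u'A by auto
  define x where "x = p \<cdot> (u \<cdot> u')"
  have x: "x \<in> homset C U' M'" unfolding x_def using p u u'A by simp
  \<comment> \<open>An arrow into \<open>M\<close> with no component in \<open>M''\<close> factors through \<open>i\<close>.\<close>
  have ipw: "i \<cdot> (p \<cdot> w) = w" if w: "w \<in> homset C A M" and z: "p'' \<cdot> w = Zero C A M''" for A w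
  proof -
    have AO: "A \<in> Obj C" using w by auto
    have w2: "i \<cdot> (p \<cdot> w) \<in> homset C A M" using i p w by simp
    have "((i \<cdot> p) \<cdot> w) \<boxplus> ((i'' \<cdot> p'') \<cdot> w) = Ident C M \<cdot> w"
      using Comp_Add_left[OF w, of "i \<cdot> p" M "i'' \<cdot> p''"] one i p i'' p'' by simp
    then have "(i \<cdot> (p \<cdot> w)) \<boxplus> Zero C A M = w" using z w i p i'' p'' AO by simp
    then show ?thesis
      using Add_simps(2,3)[OF w2, of "Zero C A M"] Add_simps(3)[OF w2 w2] AO O by simp
  qed
  have ix: "i \<cdot> x = u \<cdot> u'"
    unfolding x_def using ipw[of "u \<cdot> u'" U'] ew[of u'] eu' u u'A by simp
  define y where "y = t \<cdot> (r \<cdot> i)"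
  have y: "y \<in> homset C M' U'" unfolding y_def using t r i by simp
  have "y \<cdot> x = t \<cdot> (r \<cdot> (u \<cdot> u'))" unfolding y_def using ix t r i x by simp
  then have yx: "y \<cdot> x = Ident C U'" using Comp_extend[OF ru, of u'] tu' r u u'A by simp
  obtain k' where k': "is_kernel C k' f" using kernel_exists f by auto
  then have k'm: "is_mono C k'" and k'A: "k' \<in> Arr C" "Cod C k' = M'"
    and fk': "f \<cdot> k' = Zero C (Dom C k') N'"
    using f mono_Arr by (auto simp: is_kernel_iff)
  have "g \<cdot> (i \<cdot> k') = Zero C (Dom C k') N" using gi[of k'] k'A fk' n O by simp
  then obtain b' where b': "b' \<in> homset C (Dom C k') (Dom C k)" and kb': "k \<cdot> b' = i \<cdot> k'"
    using kernel_factor[OF k, of "i \<cdot> k'" "Dom C k'"] k'A i g by auto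
  have ujb': "u \<cdot> (j \<cdot> b') = i \<cdot> k'" using Comp_extend[OF uj, of b'] kb' u j b' by simp
  have "e \<cdot> (j \<cdot> b') = p'' \<cdot> (i \<cdot> k')" using ew[of "j \<cdot> b'"] ujb' j b' by simp
  also have "\<dots> = Zero C (Dom C k') M''" using Comp_extend[OF p''i, of k'] k'A i p'' O by simp
  finally obtain j' where j': "j' \<in> homset C (Dom C k') U'" and u'j': "u' \<cdot> j' = j \<cdot> b'"
    using kernel_factor[OF u', of "j \<cdot> b'" "Dom C k'"] j b' e U'_def by auto
  have "x \<cdot> j' = p \<cdot> (u \<cdot> (u' \<cdot> j'))" unfolding x_def using p u u'A j' by simp
  also have "\<dots> = p \<cdot> (i \<cdot> k')" using u'j' ujb' by simp
  also have "\<dots> = k'" using Comp_extend[OF pi, of k'] k'A i p by simp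
  finally have xj': "x \<cdot> j' = k'" .
  \<comment> \<open>If \<open>z\<close> is injective on \<open>Ker f\<close>, then \<open>z \<oplus> 1 : U' \<oplus> M'' \<rightarrow> B \<oplus> M''\<close> is injective on
      \<open>Ker g = Ker f \<oplus> M''\<close>, hence on \<open>U\<close>, and \<open>z\<close> is its restriction to \<open>U'\<close>.\<close>
  have "is_mono C z" if z: "z \<in> homset C (Cod C j') B" and zj': "is_mono C (z \<cdot> j')" for z B
  proof -
    have zA: "z \<in> homset C U' B" using z j' by simp
    have BO: "B \<in> Obj C" using zA by auto
    have zt: "z \<cdot> t \<in> homset C U B" using zA t by simp
    obtain S q1 q2 h where q1: "q1 \<in> homset C S B" and q2: "q2 \<in> homset C S M''"
      and h: "h \<in> homset C U S" and q1h: "q1 \<cdot> h = z \<cdot> t" and q2h: "q2 \<cdot> h = e"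
      and hz: "\<And>W w. \<lbrakk>w \<in> homset C W U; (z \<cdot> t) \<cdot> w = Zero C W B; e \<cdot> w = Zero C W M''\<rbrakk>
        \<Longrightarrow> h \<cdot> w = Zero C W S"
      using pairing_exists[OF zt e] by blast
    have "is_mono C (h \<cdot> j)"
    proof (rule mono_zeroI)
      show "h \<cdot> j \<in> Arr C" using h j by simp
      fix A w assume "w \<in> homset C A (Dom C (h \<cdot> j))"
        and "(h \<cdot> j) \<cdot> w = Zero C A (Cod C (h \<cdot> j))"
      then have w: "w \<in> homset C A (Dom C k)" and hjw: "h \<cdot> (j \<cdot> w) = Zero C A S"
        using h j by auto
      have AO: "A \<in> Obj C" using w by auto
      have jw: "j \<cdot> w \<in> homset C A U" using j w by simp
      have "e \<cdot> (j \<cdot> w) = q2 \<cdot> (h \<cdot> (j \<cdot> w))" using Comp_extend[OF q2h, of "j \<cdot> w"] h q2 jw by simp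
      also have "\<dots> = Zero C A M''" using hjw q2 AO by simp
      finally obtain v where v: "v \<in> homset C A U'" and u'v: "u' \<cdot> v = j \<cdot> w"
        using kernel_factor[OF u', of "j \<cdot> w" A] jw e U'_def by auto
      have "z \<cdot> v = (z \<cdot> t) \<cdot> (u' \<cdot> v)" using Comp_extend[OF tu', of v] zA t u'A v by simp
      also have "\<dots> = q1 \<cdot> (h \<cdot> (j \<cdot> w))"
        using Comp_extend[OF q1h, of "j \<cdot> w"] u'v h q1 jw by simp
      also have "\<dots> = Zero C A B" using hjw q1 AO by simp
      finally have zv: "z \<cdot> v = Zero C A B" .
      have kw: "k \<cdot> w = i \<cdot> (x \<cdot> v)"
        using Comp_extend[OF uj, of w] Comp_extend[OF ix, of v] u'v u j w x i v u'A by simp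
      have "n \<cdot> (f \<cdot> (x \<cdot> v)) = g \<cdot> (k \<cdot> w)" using gi[of "x \<cdot> v"] kw x v by simp
      also have "\<dots> = Zero C A N" using Comp_extend[OF gk, of w] g kA w O by auto
      finally have "f \<cdot> (x \<cdot> v) = Zero C A N'"
        using mono_zeroD[OF nm, of "f \<cdot> (x \<cdot> v)" A] n f x v by simp
      then obtain v' where v': "v' \<in> homset C A (Dom C k')" and k'v': "k' \<cdot> v' = x \<cdot> v"
        using kernel_factor[OF k', of "x \<cdot> v" A] f x v by auto
      have "x \<cdot> (j' \<cdot> v') = x \<cdot> v" using Comp_extend[OF xj', of v'] k'v' x j' v' by simp
      then have jv: "j' \<cdot> v' = v"
        using mono_cancel[OF split_mono[OF x y yx], of "j' \<cdot> v'" A v] x j' v' v by simp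
      then have "(z \<cdot> j') \<cdot> v' = Zero C A B" using zv zA j' v' by simp
      then have "v' = Zero C A (Dom C k')" using mono_zeroD[OF zj', of v' A] v' zA j' by simp
      then have "v = Zero C A U'" using jv j' AO k'A by auto
      then have "k \<cdot> w = Zero C A M" using kw x i AO O U'O by simp
      then show "w = Zero C A (Dom C (h \<cdot> j))" using mono_zeroD[OF km, of w A] w kA h j by simp
    qed
    then have hm: "is_mono C h" using reflects_monoD[OF refl, of h S] h j by simp
    show "is_mono C z"
    proof (rule mono_zeroI)
      show "z \<in> Arr C" using zA by simp
      fix A w assume "w \<in> homset C A (Dom C z)" and "z \<cdot> w = Zero C A (Cod C z)"
      then have w: "w \<in> homset C A U'" and zw: "z \<cdot> w = Zero C A B" using zA by auto
      have AO: "A \<in> Obj C" using w by auto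
      have "(z \<cdot> t) \<cdot> (u' \<cdot> w) = Zero C A B"
        using Comp_extend[OF tu', of w] zw zA t u'A w by simp
      moreover have "e \<cdot> (u' \<cdot> w) = Zero C A M''"
        using Comp_extend[OF eu', of w] e u'A w O by auto
      ultimately have "h \<cdot> (u' \<cdot> w) = Zero C A S" using hz[of "u' \<cdot> w" A] u'A w by simp
      then have "u' \<cdot> w = Zero C A U" using mono_zeroD[OF hm, of "u' \<cdot> w" A] h u'A w by simp
      then show "w = Zero C A (Dom C z)" using mono_zeroD[OF u'm, of w A] u'A w zA by simp
    qed
  qed
  then have "reflects_mono C j'" unfolding reflects_mono_def by blast
  then show "\<exists>k U u r j. is_kernel C k f \<and> u \<in> homset C U M' \<and> r \<in> homset C M' U \<and>
      r \<cdot> u = Ident C U \<and> j \<in> homset C (Dom C k) U \<and> u \<cdot> j = k \<and> reflects_mono C j"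
    using k' x y yx j' xj' by blast
qed

end

theorem corollary3p2:
  fixes C :: "('o, 'a, 'r) preadditive_cat_scheme"
    and M N M' N' :: 'o
  assumes "abelian_category C"
    and "M \<in> Obj C" and "N \<in> Obj C"
    and "direct_summand C M' M" and "direct_summand C N' N"
  shows "(cs_rickart C M N \<longrightarrow> cs_rickart C M' N') \<and>
         (dual_cs_rickart C M N \<longrightarrow> dual_cs_rickart C M' N')"
proof -
  interpret abelian_category C by fact
  interpret op: abelian_category "opposite C" by (rule abelian_category_opposite)
  show ?thesis
    unfolding dual_cs_rickart_iff_opposite
    using cs_rickart_direct_summand[OF _ assms(4,5)]
      op.cs_rickart_direct_summand[OF _ direct_summand_opposite[OF assms(5)]
        direct_summand_opposite[OF assms(4)]] by blast
qed

end
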